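(* Let $J$ satisfy (A1)–(A3), let the admissible metric families $\mathcal D_1,\dots,\mathcal D_N$ satisfy (B1)–(B3), and let $\{z^k\}_{k\in\mathbb N}$, $z^k=(x_1^k,\dots,x_N^k)$, be the sequence generated by the iGGBPL algorithm with step sizes satisfying $\inf_{i\in[N],k\ge1}(\gamma_i^k-1)s_i^k>0$ and $\inf_{i\in[N],k\ge1}\sigma_i^k>0$ (all described in the context). Then $\{z^k\}$ converges; i.e. $$\lim_{k\to\infty}\ \sup_{p\in\mathbb N}\|z^{k+p}-z^k\|_d=0,$$ and the finite-dimensional normed space with norm $\|\cdot\|_d$ is complete.
   Context: Notation: $[N]=\{1,\dots,N\}$; $\langle\cdot,\cdot\rangle,\|\cdot\|$ are the Euclidean inner product and norm. On the product space, $\|z\|_d:=\sum_{i=1}^N\|z_i\|_d$, with $\|\cdot\|_d$ on $\mathbb R^{d_i}$ as in (B1). Problem. Minimize $J(x_1,\dots,x_N)=H(x_1,\dots,x_N)+\sum_{i=1}^N F_i(x_i)$ over $\prod_{i=1}^N\mathbb R^{d_i}$. Assumptions: (A1) $H:\prod_i\mathbb R^{d_i}\to\mathbb R$ is continuously differentiable; for each $i$ and each choice of the other blocks, the partial gradient $x_i\mapsto\nabla_{x_i}H$ is Lipschitz on $\mathbb R^{d_i}$; and $\nabla H$ is Lipschitz on every bounded set. (A2) Each $F_i:\mathbb R^{d_i}\to(-\infty,+\infty]$ (equal to $+\infty$ outside a set $\mathbb D_{F_i}$) is proper, lower semicontinuous and bounded below. (A3) $J$ is a KŁ function, proper, coercive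 ($J(x)\to+\infty$ as $\|x\|\to\infty$) and bounded below. Subdifferentials and KŁ. The Fréchet subdifferential $\hat\partial f(x)$ of a proper lsc $f$ at $x\in\mathrm{dom} f$ is the set of $u$ with $\liminf_{y\to x,y\ne x}\frac{f(y)-f(x)-\langle u,y-x\rangle}{\|y-x\|}\ge0$ (empty if $x\notin\mathrm{dom} f$); the limiting subdifferential is $\partial f(x)=\{u:\exists x^k\to x, f(x^k)\to f(x), u^k\in\hat\partial f(x^k), u^k\to u\}$. A desingularization function is a concave continuous $\phi:[0,\eta)\to\mathbb R_+$ with $\phi(0)=0$, continuously differentiable on $(0,\eta)$ with $\phi'>0$. $f$ is a KŁ function if for every $\bar u$ with $\partial f(\bar u)\neq\emptyset$ there exist $\eta\in(0,+\infty]$, a neighborhood $U$ of $\bar u$ and a desingularization function $\phi$ on $[0,\eta)$ such that $\phi'(f(u)-f(\bar u))\,\mathrm{dist}(0,\partial f(u))\ge1$ for all $u\in U$ with $f(\bar u)<f(u)<f(\bar u)+\eta$. Admissible metrics. For each $i\in[N]$, $\mathcal D_i$ is a family of metrics on $\mathbb R^{d_i}$ such that: (B1) there exist a norm $\|\cdot\|_d$ (on $\mathbb R^{d_i}$) and a constant $C_d>0$ with $C_d\|x-y\|_d\le d(x,y)$ for all $x,y\in\mathbb R^{d_i}$, $d\in\mathcal D_i$; (B2) $d(\cdot,y)$ is convex for every $y\in\mathbb R^{d_i}$, $d\in\mathcal D_i$; (B3) $\omega_i(x,y):=\sup_{d\in\mathcal D_i}d(x,y)$ is bounded on every compact subset of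 $\mathbb R^{d_i}\times\mathbb R^{d_i}$. iGGBPL algorithm. Input: $x^1_{(N)}=x^0_{(N)}\in\mathrm{dom}\,J$, where $x^k_{(N)}=(x_1^k,\dots,x_N^k)$; $\rho_1>0$, $\beta^1=0$, $t_1=1$. For $k=1,2,3,\dots$: (1) Set $y_i^k=x_i^k+\beta^k(x_i^k-x_i^{k-1})$ for all $i$. (2) For $i=1,\dots,N$ successively: put $h_i(c)=H(x_1^{k+1},\dots,x_{i-1}^{k+1},c,x_{i+1}^k,\dots,x_N^k)$; choose any inner product $\langle u,v\rangle_{i,k}=\langle R_{i,k}u,v\rangle$ on $\mathbb R^{d_i}$ ($R_{i,k}$ symmetric positive definite) and any $d_i^k\in\mathcal D_i$; let $L_{i,k}>0$ be a constant such that $h_i(v)\le h_i(u)+\langle R_{i,k}^{-1}\nabla h_i(u),v-u\rangle_{i,k}+\frac{L_{i,k}}2(d_i^k(v,u))^2$ for all $u,v\in\mathbb R^{d_i}$; choose $s_i^k>L_{i,k}$, $\gamma_i^k>1$, $\sigma_i^k=1/(\gamma_i^ks_i^k)$; and choose $$x_i^{k+1}\in\arg\min_{x}\Big[F_i(x)+\tfrac1{2\sigma_i^k}(d_i^k(x,y_i^k))^2+\langle R_{i,k}^{-1}\nabla h_i(y_i^k),x-y_i^k\rangle_{i,k}\Big].$$ (3) If $J(x^{k+1}_{(N)})>J(x^k_{(N)})-\rho_1\sum_i(d_i^k(x_i^{k+1},x_i^k))^2$, set $\beta^k=0$ and redo (1)–(2) once (so that $y_i^k=x_i^k$); the result of this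 second pass is the final $x^{k+1}_{(N)}$. (4) $t_{k+1}=\frac{1+\sqrt{1+4t_k^2}}2$, $\beta^{k+1}=t_k/t_{k+1}$. All quantities with index $k$ refer to the pass that produced the final $x_{(N)}^{k+1}$. *)

theory Defs
  imports "HOL-Analysis.Analysis"
begin

text \<open>
  The product of R^{d_1}, ..., R^{d_N} is the Euclidean space \<open>real^'n\<close>, where \<open>b\<close> assigns to every
  coordinate the number of the block it belongs to; thus \<open>d_i\<close> is the number of coordinates \<open>j\<close>
  with \<open>b j = i\<close>, and the i-th factor is identified with the vectors supported on block \<open>i\<close>.
  Data living on the i-th factor (\<open>F i\<close>, metrics, norms, linear maps) are given as functions on
  \<open>real^'n\<close> of which only the values on \<open>block_space b i\<close> matter.
\<close>

definition is_block_map :: "('n::finite \<Rightarrow> nat) \<Rightarrow> nat \<Rightarrow> bool" where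
  "is_block_map b N \<longleftrightarrow> range b = {1..N}"

definition block_space :: "('n::finite \<Rightarrow> nat) \<Rightarrow> nat \<Rightarrow> (real^'n) set" where
  "block_space b i = {v. \<forall>j. b j \<noteq> i \<longrightarrow> v $ j = 0}"

definition block_part :: "('n::finite \<Rightarrow> nat) \<Rightarrow> nat \<Rightarrow> real^'n \<Rightarrow> real^'n" where
  "block_part b i x = (\<chi> j. if b j = i then x $ j else 0)"

text \<open>
  \<open>splice b i u c v\<close> is the point \<open>(u_1, ..., u_{i-1}, c, v_{i+1}, ..., v_N)\<close>.
\<close>

definition splice :: "('n::finite \<Rightarrow> nat) \<Rightarrow> nat \<Rightarrow> real^'n \<Rightarrow> real^'n \<Rightarrow> real^'n \<Rightarrow> real^'n" where
  "splice b i u c v = (\<chi> j. if b j < i then u $ j else if b j = i then c $ j else v $ j)"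

text \<open>The gradient of a function on a linear subspace \<open>V\<close>, with the inner product of the whole space.\<close>

definition gradient_on :: "'a::real_inner set \<Rightarrow> ('a \<Rightarrow> real) \<Rightarrow> 'a \<Rightarrow> 'a" where
  "gradient_on V f x = (THE D. D \<in> V \<and> (f has_derivative (\<lambda>h. h \<bullet> D)) (at x within V))"

abbreviation gradient :: "('a::real_inner \<Rightarrow> real) \<Rightarrow> 'a \<Rightarrow> 'a" where
  "gradient \<equiv> gradient_on UNIV"

definition edom :: "('a \<Rightarrow> ereal) \<Rightarrow> 'a set" where
  "edom f = {x. f x < \<infinity>}"

definition proper_on :: "'a set \<Rightarrow> ('a \<Rightarrow> ereal) \<Rightarrow> bool" where
  "proper_on S f \<longleftrightarrow> (\<forall>x\<in>S. f x \<noteq> -\<infinity>) \<and> (\<exists>x\<in>S. f x < \<infinity>)"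

definition lsc_on :: "'a::topological_space set \<Rightarrow> ('a \<Rightarrow> ereal) \<Rightarrow> bool" where
  "lsc_on S f \<longleftrightarrow> (\<forall>x\<in>S. f x \<le> Liminf (at x within S) f)"

definition ebdd_below_on :: "'a set \<Rightarrow> ('a \<Rightarrow> ereal) \<Rightarrow> bool" where
  "ebdd_below_on S f \<longleftrightarrow> (\<exists>m::real. \<forall>x\<in>S. ereal m \<le> f x)"

definition ecoercive :: "('a::real_normed_vector \<Rightarrow> ereal) \<Rightarrow> bool" where
  "ecoercive f \<longleftrightarrow> (f \<longlongrightarrow> \<infinity>) at_infinity"

definition frechet_subdiff :: "('a::real_inner \<Rightarrow> ereal) \<Rightarrow> 'a \<Rightarrow> 'a set" where
  "frechet_subdiff f x = {u. x \<in> edom f \<and>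
     0 \<le> Liminf (at x) (\<lambda>y. (f y - f x - ereal (u \<bullet> (y - x))) / ereal (norm (y - x)))}"

text \<open>Like the Frechet subdifferential, the limiting one is only considered at points of the domain.\<close>

definition limiting_subdiff :: "('a::real_inner \<Rightarrow> ereal) \<Rightarrow> 'a \<Rightarrow> 'a set" where
  "limiting_subdiff f x = {u. x \<in> edom f \<and> (\<exists>X U. X \<longlonglongrightarrow> x \<and> (\<lambda>k. f (X k)) \<longlonglongrightarrow> f x \<and>
     (\<forall>k. U k \<in> frechet_subdiff f (X k)) \<and> U \<longlonglongrightarrow> u)}"

text \<open>
  The distance to the empty set is \<open>\<infinity>\<close>, as usual in this context; the library's \<open>infdist\<close>
  would return 0.
\<close>

definition edist_set :: "'a::metric_space \<Rightarrow> 'a set \<Rightarrow> ereal" where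
  "edist_set x A = (INF a\<in>A. ereal (dist x a))"

definition desingularization :: "ereal \<Rightarrow> (real \<Rightarrow> real) \<Rightarrow> bool" where
  "desingularization \<eta> \<phi> \<longleftrightarrow>
     concave_on {t. 0 \<le> t \<and> ereal t < \<eta>} \<phi> \<and>
     continuous_on {t. 0 \<le> t \<and> ereal t < \<eta>} \<phi> \<and>
     (\<forall>t. 0 \<le> t \<and> ereal t < \<eta> \<longrightarrow> 0 \<le> \<phi> t) \<and>
     \<phi> 0 = 0 \<and>
     (\<forall>t. 0 < t \<and> ereal t < \<eta> \<longrightarrow> \<phi> differentiable (at t)) \<and>
     continuous_on {t. 0 < t \<and> ereal t < \<eta>} (deriv \<phi>) \<and>
     (\<forall>t. 0 < t \<and> ereal t < \<eta> \<longrightarrow> 0 < deriv \<phi> t)"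

definition KL_function :: "('a::real_inner \<Rightarrow> ereal) \<Rightarrow> bool" where
  "KL_function f \<longleftrightarrow> (\<forall>ub. limiting_subdiff f ub \<noteq> {} \<longrightarrow>
     (\<exists>\<eta> U \<phi>. 0 < \<eta> \<and> open U \<and> ub \<in> U \<and> desingularization \<eta> \<phi> \<and>
        (\<forall>u\<in>U. f ub < f u \<and> f u < f ub + \<eta> \<longrightarrow>
           1 \<le> ereal (deriv \<phi> (real_of_ereal (f u - f ub))) * edist_set 0 (limiting_subdiff f u))))"

definition objective ::
  "('n::finite \<Rightarrow> nat) \<Rightarrow> nat \<Rightarrow> (real^'n \<Rightarrow> real) \<Rightarrow> (nat \<Rightarrow> real^'n \<Rightarrow> ereal) \<Rightarrow> real^'n \<Rightarrow> ereal" where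
  "objective b N H F x = ereal (H x) + (\<Sum>i=1..N. F i (block_part b i x))"

definition assumption_A1 :: "('n::finite \<Rightarrow> nat) \<Rightarrow> nat \<Rightarrow> (real^'n \<Rightarrow> real) \<Rightarrow> bool" where
  "assumption_A1 b N H \<longleftrightarrow>
     (\<forall>x. H differentiable (at x)) \<and> continuous_on UNIV (gradient H) \<and>
     (\<forall>i\<in>{1..N}. \<forall>x. \<exists>L. L-lipschitz_on (block_space b i)
        (gradient_on (block_space b i) (\<lambda>c. H (splice b i x c x)))) \<and>
     (\<forall>B. bounded B \<longrightarrow> (\<exists>L. L-lipschitz_on B (gradient H)))"

definition assumption_A2 :: "('n::finite \<Rightarrow> nat) \<Rightarrow> nat \<Rightarrow> (nat \<Rightarrow> real^'n \<Rightarrow> ereal) \<Rightarrow> bool" where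
  "assumption_A2 b N F \<longleftrightarrow> (\<forall>i\<in>{1..N}. proper_on (block_space b i) (F i) \<and>
     lsc_on (block_space b i) (F i) \<and> ebdd_below_on (block_space b i) (F i))"

definition assumption_A3 :: "(real^'n::finite \<Rightarrow> ereal) \<Rightarrow> bool" where
  "assumption_A3 J \<longleftrightarrow> KL_function J \<and> proper_on UNIV J \<and> ecoercive J \<and> ebdd_below_on UNIV J"

definition norm_on :: "'a::real_vector set \<Rightarrow> ('a \<Rightarrow> real) \<Rightarrow> bool" where
  "norm_on V n \<longleftrightarrow> (\<forall>x\<in>V. 0 \<le> n x \<and> (n x = 0 \<longleftrightarrow> x = 0)) \<and>
     (\<forall>x\<in>V. \<forall>c. n (c *\<^sub>R x) = \<bar>c\<bar> * n x) \<and> (\<forall>x\<in>V. \<forall>y\<in>V. n (x + y) \<le> n x + n y)"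

definition metric_sup :: "('a \<Rightarrow> 'a \<Rightarrow> real) set \<Rightarrow> 'a \<Rightarrow> 'a \<Rightarrow> ereal" where
  "metric_sup \<D> x y = (SUP d\<in>\<D>. ereal (d x y))"

text \<open>
  Below, \<open>V\<close> is the factor carrying the metrics and \<open>nd\<close> a norm they all dominate. The library predicate
  \<open>Metric_space\<close> also asks for symmetry and nonnegativity off \<open>V\<close>; the values there play no role,
  and every metric on \<open>V\<close> satisfies this when extended by 0.
\<close>

definition admissible_metrics ::
  "'a::real_normed_vector set \<Rightarrow> ('a \<Rightarrow> real) \<Rightarrow> ('a \<Rightarrow> 'a \<Rightarrow> real) set \<Rightarrow> bool" where
  "admissible_metrics V nd \<D> \<longleftrightarrow>
     (\<forall>d\<in>\<D>. Metric_space V d) \<and>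
     norm_on V nd \<and> (\<exists>C>0. \<forall>d\<in>\<D>. \<forall>x\<in>V. \<forall>y\<in>V. C * nd (x - y) \<le> d x y) \<and>
     (\<forall>d\<in>\<D>. \<forall>y\<in>V. convex_on V (\<lambda>x. d x y)) \<and>
     (\<forall>K. compact K \<and> K \<subseteq> V \<times> V \<longrightarrow>
        (\<exists>M::real. \<forall>(x, y)\<in>K. \<bar>metric_sup \<D> x y\<bar> \<le> ereal M))"

definition prod_norm :: "('n::finite \<Rightarrow> nat) \<Rightarrow> nat \<Rightarrow> (nat \<Rightarrow> real^'n \<Rightarrow> real) \<Rightarrow> real^'n \<Rightarrow> real" where
  "prod_norm b N nd z = (\<Sum>i=1..N. nd i (block_part b i z))"

fun t_seq :: "nat \<Rightarrow> real" where
  "t_seq 0 = 1" \<comment> \<open>not used\<close>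
| "t_seq (Suc 0) = 1"
| "t_seq (Suc (Suc k)) = (1 + sqrt (1 + 4 * (t_seq (Suc k))\<^sup>2)) / 2"

definition beta_seq :: "nat \<Rightarrow> real" where
  "beta_seq k = (if k \<le> 1 then 0 else t_seq (k - 1) / t_seq k)"

definition spd_on :: "'a::real_inner set \<Rightarrow> ('a \<Rightarrow> 'a) \<Rightarrow> bool" where
  "spd_on V R \<longleftrightarrow> linear R \<and> R ` V \<subseteq> V \<and> (\<forall>u\<in>V. \<forall>v\<in>V. R u \<bullet> v = u \<bullet> R v) \<and>
     (\<forall>u\<in>V. u \<noteq> 0 \<longrightarrow> 0 < R u \<bullet> u)"

definition weighted_inner :: "('a::real_inner \<Rightarrow> 'a) \<Rightarrow> 'a \<Rightarrow> 'a \<Rightarrow> real" where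
  "weighted_inner R u v = R u \<bullet> v"

text \<open>
  One pass of the block updates of a fixed iteration: \<open>x\<close> is the current iterate, \<open>y\<close> the
  extrapolated point and \<open>x'\<close> the result. Blocks \<open>1, ..., i-1\<close> of \<open>x'\<close> have already been computed
  when block \<open>i\<close> is treated. The parameters \<open>R\<close>, \<open>d\<close>, \<open>L\<close>, \<open>s\<close>, \<open>\<gamma>\<close>, \<open>\<sigma>\<close> are indexed by the block.
\<close>

definition block_pass ::
  "('n::finite \<Rightarrow> nat) \<Rightarrow> nat \<Rightarrow> (real^'n \<Rightarrow> real) \<Rightarrow> (nat \<Rightarrow> real^'n \<Rightarrow> ereal) \<Rightarrow>
   (nat \<Rightarrow> (real^'n \<Rightarrow> real^'n \<Rightarrow> real) set) \<Rightarrow>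
   (nat \<Rightarrow> real^'n \<Rightarrow> real^'n) \<Rightarrow> (nat \<Rightarrow> real^'n \<Rightarrow> real^'n \<Rightarrow> real) \<Rightarrow>
   (nat \<Rightarrow> real) \<Rightarrow> (nat \<Rightarrow> real) \<Rightarrow> (nat \<Rightarrow> real) \<Rightarrow> (nat \<Rightarrow> real) \<Rightarrow>
   real^'n \<Rightarrow> real^'n \<Rightarrow> real^'n \<Rightarrow> bool" where
  "block_pass b N H F \<D> R d L s \<gamma> \<sigma> x y x' \<longleftrightarrow> (\<forall>i\<in>{1..N}.
     (let V = block_space b i;
          h = (\<lambda>c. H (splice b i x' c x));
          g = (\<lambda>u. inv_into V (R i) (gradient_on V h u));
          yi = block_part b i y
      in spd_on V (R i) \<and> d i \<in> \<D> i \<and> 0 < L i \<and>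
         (\<forall>u\<in>V. \<forall>v\<in>V. h v \<le> h u + weighted_inner (R i) (g u) (v - u) + L i / 2 * (d i v u)\<^sup>2) \<and>
         s i > L i \<and> \<gamma> i > 1 \<and> \<sigma> i = 1 / (\<gamma> i * s i) \<and>
         is_arg_min
           (\<lambda>c. F i c + ereal (1 / (2 * \<sigma> i) * (d i c yi)\<^sup>2 + weighted_inner (R i) (g yi) (c - yi)))
           (\<lambda>c. c \<in> V) (block_part b i x')))"

definition redo_needed ::
  "('n::finite \<Rightarrow> nat) \<Rightarrow> nat \<Rightarrow> (real^'n \<Rightarrow> ereal) \<Rightarrow> real \<Rightarrow>
   (nat \<Rightarrow> real^'n \<Rightarrow> real^'n \<Rightarrow> real) \<Rightarrow> real^'n \<Rightarrow> real^'n \<Rightarrow> bool" where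
  "redo_needed b N J \<rho> d x x' \<longleftrightarrow>
     J x' > J x - ereal (\<rho> * (\<Sum>i=1..N. (d i (block_part b i x') (block_part b i x))\<^sup>2))"

text \<open>
  Parameters carry the iteration index first and the block index second, and belong to the pass
  that produced the final \<open>x (k + 1)\<close>. A rejected first pass may have used other parameters.
\<close>

definition iGGBPL ::
  "('n::finite \<Rightarrow> nat) \<Rightarrow> nat \<Rightarrow> (real^'n \<Rightarrow> real) \<Rightarrow> (nat \<Rightarrow> real^'n \<Rightarrow> ereal) \<Rightarrow>
   (nat \<Rightarrow> (real^'n \<Rightarrow> real^'n \<Rightarrow> real) set) \<Rightarrow> real \<Rightarrow>
   (nat \<Rightarrow> nat \<Rightarrow> real^'n \<Rightarrow> real^'n) \<Rightarrow> (nat \<Rightarrow> nat \<Rightarrow> real^'n \<Rightarrow> real^'n \<Rightarrow> real) \<Rightarrow>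
   (nat \<Rightarrow> nat \<Rightarrow> real) \<Rightarrow> (nat \<Rightarrow> nat \<Rightarrow> real) \<Rightarrow> (nat \<Rightarrow> nat \<Rightarrow> real) \<Rightarrow> (nat \<Rightarrow> nat \<Rightarrow> real) \<Rightarrow>
   (nat \<Rightarrow> real^'n) \<Rightarrow> bool" where
  "iGGBPL b N H F \<D> \<rho> R d L s \<gamma> \<sigma> x \<longleftrightarrow>
     x 1 = x 0 \<and> x 0 \<in> edom (objective b N H F) \<and> 0 < \<rho> \<and>
     (\<forall>k\<ge>1.
        let J = objective b N H F;
            y = x k + beta_seq k *\<^sub>R (x k - x (k - 1))
        in (block_pass b N H F \<D> (R k) (d k) (L k) (s k) (\<gamma> k) (\<sigma> k) (x k) y (x (k + 1)) \<and>
              \<not> redo_needed b N J \<rho> (d k) (x k) (x (k + 1)))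
         \<or> ((\<exists>R' d' L' s' \<gamma>' \<sigma>' x'.
                block_pass b N H F \<D> R' d' L' s' \<gamma>' \<sigma>' (x k) y x' \<and> redo_needed b N J \<rho> d' (x k) x') \<and>
              block_pass b N H F \<D> (R k) (d k) (L k) (s k) (\<gamma> k) (\<sigma> k) (x k) (x k) (x (k + 1))))"

end

theory Submission
  imports Defs
begin

text \<open>
  Comparing the minimality of each block update with an arbitrary competitor, and using that the metrics
  are locally Lipschitz by (B2) and (B3), shows that \<open>J\<close> lies near \<open>p = z (k + 1)\<close> above the concave cusp
  \<open>J p - E * |c - p| - A * |c - p|\<^sup>2\<close>, where \<open>E\<close> is bounded by a multiple of the last two step
  lengths. Minimizing \<open>J\<close> plus a smooth approximation of the cusp yields a limiting subgradient at \<open>p\<close>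
  of norm at most \<open>E\<close>, so that no sum rule for the nonsmooth metrics is needed. The same estimate, passed to
  the limit, shows that \<open>J\<close> converges to its value at every cluster point \<open>x\<close> and that \<open>J\<close> has a
  limiting subgradient there. Together with the sufficient decrease of \<open>J\<close>, the KL inequality at \<open>x\<close>
  makes \<open>dist (z k) x + 2 * P k\<close> nonincreasing near \<open>x\<close>, where \<open>P k\<close> is a multiple of
  \<open>\<phi> (J (z k) - J x)\<close> plus a combination of the last two step lengths; hence \<open>z\<close> converges to \<open>x\<close>.
\<close>

text \<open>The metrics may change in every iteration and need not be differentiable; they enter the
  cusp bound only through the metric axioms and one constant \<open>M\<close> with
  \<open>d u v \<le> M * norm (u - v)\<close> on a ball that contains the iterates and the
  extrapolated points. Two step lengths occur in \<open>E\<close> because gradient and metric are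
  centred at the extrapolated point, which lies within one previous step of the current iterate
  since the weights lie in [0, 1]. A bound on the values of \<open>J\<close> over a ball of fixed
  radius, unlike a bound on subgradients, passes to a limit although \<open>J\<close> is only lower
  semicontinuous: at a cluster point it bounds \<open>J x\<close> below by the limit of the values,
  while semicontinuity gives the converse. One cluster point is enough: the monotone quantity traps
  the sequence in a small ball around it, so a single neighbourhood and a single \<phi> serve the
  whole tail.\<close>

section \<open>Lower semicontinuous extended-real functions\<close>

lemma lsc_on_UNIV_iff:
  fixes f :: "'a::topological_space \<Rightarrow> ereal"
  shows "lsc_on UNIV f \<longleftrightarrow> (\<forall>x. \<forall>a<f x. \<forall>\<^sub>F y in nhds x. a < f y)"
  unfolding lsc_on_def le_Liminf_iff eventually_nhds_conv_at by auto

lemma ereal_less_add_cases: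
  fixes x y a :: ereal
  assumes "a < x + y" "x \<noteq> -\<infinity>" "y \<noteq> -\<infinity>"
  obtains u v where "ereal u < x" "ereal v < y" "a < ereal u + ereal v"
proof -
  obtain w where w: "a < ereal w" "ereal w < x + y" using ereal_dense2[OF assms(1)] by auto
  show thesis
  proof (cases x)
    case x: (real p)
    show thesis
    proof (cases y)
      case y: (real q)
      define e where "e = (p + q - w) / 2"
      have "e > 0" using w(2) x y by (simp add: e_def)
      moreover have "(p - e) + (q - e) = w" by (simp add: e_def field_simps)
      ultimately show thesis using that[of "p - e" "q - e"] w x y by simp
    next
      case PInf
      then show thesis using that[of "p - 1" "w - (p - 1)"] w x by simp
    qed (use assms in auto)
  next
    case x: PInf
    show thesis
    proof (cases y)
      case y: (real q)
      then show thesis using that[of "w - (q - 1)" "q - 1"] w x by simp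
    next
      case PInf
      then show thesis using that[of w 0] w x by simp
    qed (use assms in auto)
  qed (use assms in auto)
qed

lemma lsc_on_add:
  fixes f g :: "'a::topological_space \<Rightarrow> ereal"
  assumes f: "lsc_on UNIV f" and g: "lsc_on UNIV g"
    and nf: "\<And>x. f x \<noteq> -\<infinity>" and ng: "\<And>x. g x \<noteq> -\<infinity>"
  shows "lsc_on UNIV (\<lambda>x. f x + g x)"
  unfolding lsc_on_UNIV_iff
proof (intro allI impI)
  fix x a assume "a < f x + g x"
  then obtain u v where uv: "ereal u < f x" "ereal v < g x" "a < ereal u + ereal v"
    using nf ng by (rule ereal_less_add_cases)
  have "\<forall>\<^sub>F y in nhds x. ereal u < f y" "\<forall>\<^sub>F y in nhds x. ereal v < g y"
    using f g uv unfolding lsc_on_UNIV_iff by auto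
  then show "\<forall>\<^sub>F y in nhds x. a < f y + g y"
  proof eventually_elim
    case (elim y)
    then have "ereal u + ereal v \<le> f y + g y" by (intro add_mono) auto
    with uv(3) show ?case by (rule less_le_trans)
  qed
qed

lemma lsc_on_ereal:
  fixes g :: "'a::topological_space \<Rightarrow> real"
  assumes "continuous_on UNIV g"
  shows "lsc_on UNIV (\<lambda>x. ereal (g x))"
  unfolding lsc_on_UNIV_iff
proof (intro allI impI)
  fix x a assume a: "a < ereal (g x)"
  have "(g \<longlongrightarrow> g x) (at x)" using assms unfolding continuous_on_def by auto
  then have "((\<lambda>y. ereal (g y)) \<longlongrightarrow> ereal (g x)) (nhds x)"
    by (simp add: tendsto_at_iff_tendsto_nhds)
  then show "\<forall>\<^sub>F y in nhds x. a < ereal (g y)" using a by (rule order_tendstoD)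
qed

text \<open>Without a minimizer the open sets where \<open>f\<close> exceeds \<open>f c\<close>
  would cover \<open>S\<close>. In a finite subcover the centre of least value lies in none of the
  sets.\<close>

lemma lsc_attains_inf:
  fixes f :: "'a::topological_space \<Rightarrow> ereal"
  assumes lsc: "lsc_on UNIV f" and S: "compact S" "S \<noteq> {}"
  shows "\<exists>c\<in>S. \<forall>x\<in>S. f c \<le> f x"
proof (rule ccontr)
  assume "\<not> ?thesis"
  then have *: "\<forall>c\<in>S. \<exists>x\<in>S. f x < f c" by (force simp: not_le)
  have op: "open {x. a < f x}" for a
    unfolding open_subopen[of "{x. a < f x}"]
  proof
    fix x assume "x \<in> {x. a < f x}"
    then have "\<forall>\<^sub>F y in nhds x. a < f y" using lsc unfolding lsc_on_UNIV_iff by simp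
    then show "\<exists>T. open T \<and> x \<in> T \<and> T \<subseteq> {x. a < f x}" unfolding eventually_nhds by auto
  qed
  have sub: "S \<subseteq> (\<Union>c\<in>S. {x. f c < f x})" using * by auto
  obtain T where T: "T \<subseteq> S" "finite T" "S \<subseteq> (\<Union>c\<in>T. {x. f c < f x})"
    using compactE_image[OF S(1) op sub] by blast
  then have "T \<noteq> {}" using S(2) by auto
  then have "Min (f ` T) \<in> f ` T" using T(2) by simp
  then obtain m where m: "m \<in> T" "f m = Min (f ` T)" by auto
  have "m \<in> (\<Union>c\<in>T. {x. f c < f x})" using m(1) T by auto
  then obtain c where "c \<in> T" "f c < Min (f ` T)" using m(2) by auto
  moreover from this T(2) have "Min (f ` T) \<le> f c" by (intro Min_le) auto
  ultimately show False by simp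
qed

section \<open>Subgradients from minimality\<close>

text \<open>Minimality of \<open>f + g\<close> bounds the difference quotient of \<open>f\<close>
  below by minus the remainder quotient of \<open>g\<close>, which tends to 0. Fermat's rule with a
  differentiable perturbation is the only source of Frechet subgradients here.\<close>

lemma frechet_subdiff_minimizer:
  fixes f :: "'a::real_inner \<Rightarrow> ereal"
  assumes fin: "\<bar>f c\<bar> \<noteq> \<infinity>" and g: "(g has_derivative (\<lambda>h. - (u \<bullet> h))) (at c)"
    and min: "\<forall>\<^sub>F y in at c. f c + ereal (g c) \<le> f y + ereal (g y)"
  shows "u \<in> frechet_subdiff f c"
proof -
  obtain r where r: "f c = ereal r" using fin by auto
  define q where "q y = norm (g y - g c - - (u \<bullet> (y - c))) / norm (y - c)" for y
  have "(q \<longlongrightarrow> 0) (at c)"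
    using g unfolding has_derivative_iff_norm q_def by simp
  then have "((\<lambda>y. - q y) \<longlongrightarrow> - 0) (at c)" by (rule tendsto_minus)
  then have lim: "((\<lambda>y. ereal (- q y)) \<longlongrightarrow> ereal 0) (at c)" by simp
  have "\<forall>\<^sub>F y in at c. ereal (- q y) \<le> (f y - f c - ereal (u \<bullet> (y - c))) / ereal (norm (y - c))"
    using min eventually_neq_at_within[of c c UNIV]
  proof (eventually_elim, goal_cases)
    case (1 y)
    then have n: "norm (y - c) > 0" 
      by simp
    show ?case
    proof (cases "f y")
      case (real w)
      then have "r + g c \<le> w + g y" using 1 r by simp
      then have "- norm (g y - g c - - (u \<bullet> (y - c))) \<le> w - r - u \<bullet> (y - c)" by simp
      from divide_right_mono[OF this norm_ge_zero, of "y - c"] show ?thesis using n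
        by (simp add: real r q_def)
    next
      case PInf then show ?thesis using n r by simp
    next
      case MInf then show ?thesis using 1 r by simp
    qed
  qed
  then have "Liminf (at c) (\<lambda>y. ereal (- q y))
      \<le> Liminf (at c) (\<lambda>y. (f y - f c - ereal (u \<bullet> (y - c))) / ereal (norm (y - c)))"
    by (rule Liminf_mono)
  moreover have "0 \<le> Liminf (at c) (\<lambda>y. ereal (- q y))"
  \<comment> \<open>In a zero-dimensional space \<open>at c\<close> is the trivial filter, and the
    Liminf is then \<open>top\<close>.\<close>
  proof (cases "at c = bot")
    case True then show ?thesis by (simp add: top_ereal_def)
  next
    case False then show ?thesis using lim_imp_Liminf[OF False lim] by (simp add: zero_ereal_def)
  qed
  ultimately show ?thesis
    unfolding frechet_subdiff_def edom_def using r by auto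
qed

text \<open>Adding the cusp to \<open>f\<close> makes \<open>p\<close> a minimizer, but the cusp has
  a kink exactly at \<open>p\<close>. Smoothing the kink moves the minimizers slightly away from
  \<open>p\<close>; there the smooth Fermat rule applies, and their subgradients accumulate at the
  desired one.\<close>

lemma limiting_subgradient_if_approx_minimal:
  fixes f :: "'a::euclidean_space \<Rightarrow> ereal"
  assumes lsc: "lsc_on UNIV f" and fp: "f p = ereal r" and \<delta>: "\<delta> > 0" and E: "E \<ge> 0" and A: "A \<ge> 0"
    and low: "\<And>c. dist c p \<le> \<delta> \<Longrightarrow> ereal (r - E * norm (c - p) - A * (norm (c - p))\<^sup>2) \<le> f c"
  shows "\<exists>u\<in>limiting_subdiff f p. norm u \<le> E"
proof -
  define e where "e n = inverse (real (Suc n))" for n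
  have e: "e n > 0" for n by (simp add: e_def)
  have e0: "e \<longlonglongrightarrow> 0" unfolding e_def by (rule LIMSEQ_inverse_real_of_nat)
  \<comment> \<open>\<open>G n\<close> is a smooth majorant of the cusp term, and \<open>W n\<close>
    is minus its gradient. The coefficient \<open>A + 1\<close> leaves one spare square, which will
    force the minimizers towards \<open>p\<close>.\<close>
  define G where "G n c = E * sqrt ((norm (c - p))\<^sup>2 + (e n)\<^sup>2) + (A + 1) * (norm (c - p))\<^sup>2" for n c
  define W where "W n c = - ((E / sqrt ((norm (c - p))\<^sup>2 + (e n)\<^sup>2) + 2 * (A + 1)) *\<^sub>R (c - p))" for n c
  have pos: "0 < (norm (c - p))\<^sup>2 + (e n)\<^sup>2" for n c
    using e[of n] by (simp add: add_nonneg_pos)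
  have dG: "(G n has_derivative (\<lambda>h. - (W n c \<bullet> h))) (at c)" for n c
  proof -
    let ?s = "(c - p) \<bullet> (c - p)"
    have nz: "?s + (e n)\<^sup>2 > 0" using pos[of c n] by (simp add: power2_norm_eq_inner)
    have "((\<lambda>c. (c - p) \<bullet> (c - p)) has_derivative (\<lambda>h. 2 * ((c - p) \<bullet> h))) (at c)"
    proof -
      have "((\<lambda>c. c - p) has_derivative (\<lambda>h. h)) (at c)"
        using has_derivative_diff[OF has_derivative_ident has_derivative_const] by simp
      from has_derivative_inner[OF this this] show ?thesis by (simp add: inner_commute)
    qed
    note d1 = this
    \<comment> \<open>\<open>G n\<close> is differentiated through the squared norm, which is smooth
      even at \<open>p\<close>.\<close>
    define \<theta> where "\<theta> t = E * sqrt (t + (e n)\<^sup>2) + (A + 1) * t" for t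
    have d2: "(\<theta> has_real_derivative E * (inverse (sqrt (?s + (e n)\<^sup>2)) / 2 * 1) + (A + 1) * 1) (at ?s)"
      unfolding \<theta>_def
    proof (intro DERIV_add DERIV_cmult DERIV_ident)
      have "((\<lambda>t. t + (e n)\<^sup>2) has_real_derivative 1) (at ?s)" by (auto intro!: derivative_eq_intros)
      with DERIV_real_sqrt[OF nz] show "((\<lambda>t. sqrt (t + (e n)\<^sup>2)) has_real_derivative
          inverse (sqrt (?s + (e n)\<^sup>2)) / 2 * 1) (at ?s)" by (rule DERIV_chain2)
    qed
    have "G n = (\<lambda>c. \<theta> ((c - p) \<bullet> (c - p)))"
      by (simp add: G_def \<theta>_def fun_eq_iff power2_norm_eq_inner)
    moreover have "(\<lambda>h. (2 * ((c - p) \<bullet> h)) * (E * (inverse (sqrt (?s + (e n)\<^sup>2)) / 2 * 1) + (A + 1) * 1)) =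
        (\<lambda>h. - (W n c \<bullet> h))"
      unfolding W_def power2_norm_eq_inner inner_minus_left inner_scaleR_left by (simp add: field_simps)
    ultimately show ?thesis using DERIV_compose_FDERIV[OF d2 d1] by simp
  qed
  have W: "norm (W n c) \<le> E + 2 * (A + 1) * norm (c - p)" for n c
  proof -
    let ?s = "sqrt ((norm (c - p))\<^sup>2 + (e n)\<^sup>2)"
    have s: "?s > 0" "norm (c - p) \<le> ?s" using pos[of c n] by (auto simp: real_le_rsqrt)
    have "E / ?s * norm (c - p) \<le> E"
      using s E mult_left_mono[OF s(2) E] by (simp add: field_simps)
    moreover have "norm (W n c) = (E / ?s + 2 * (A + 1)) * norm (c - p)"
      unfolding W_def using s E A by simp
    ultimately show ?thesis by (simp add: algebra_simps)
  qed
  have "\<exists>c\<in>cball p \<delta>. \<forall>x\<in>cball p \<delta>. f c + ereal (G n c) \<le> f x + ereal (G n x)" for n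
  proof -
    \<comment> \<open>\<open>f\<close> is known to be bounded below only on the ball. The truncation
      keeps its values there and excludes the value minus infinity elsewhere, as
      \<open>lsc_on_add\<close> demands.\<close>
    let ?f = "\<lambda>x. max (f x) (ereal (r - E * \<delta> - A * \<delta>\<^sup>2))"
    have m: "?f x = f x" if "x \<in> cball p \<delta>" for x
    proof -
      have d: "norm (x - p) \<le> \<delta>" using that by (simp add: dist_norm norm_minus_commute)
      have "r - E * \<delta> - A * \<delta>\<^sup>2 \<le> r - E * norm (x - p) - A * (norm (x - p))\<^sup>2"
        using mult_left_mono[OF d E] mult_left_mono[OF power_mono[OF d, of 2] A] by simp
      then have "ereal (r - E * \<delta> - A * \<delta>\<^sup>2) \<le> ereal (r - E * norm (x - p) - A * (norm (x - p))\<^sup>2)" by simp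
      also have "\<dots> \<le> f x" using low[of x] that by (simp add: dist_commute)
      finally show ?thesis by (rule max_absorb1)
    qed
    have "lsc_on UNIV ?f" using lsc unfolding lsc_on_UNIV_iff
      by (auto simp: less_max_iff_disj elim: eventually_mono)
    moreover have "continuous_on UNIV (G n)"
      unfolding G_def by (intro continuous_intros)
    ultimately have "lsc_on UNIV (\<lambda>x. ?f x + ereal (G n x))"
      by (intro lsc_on_add lsc_on_ereal) (auto simp: max_def)
    moreover have "cball p \<delta> \<noteq> {}" using \<delta> by simp
    ultimately obtain c where "c \<in> cball p \<delta>"
        "\<forall>x\<in>cball p \<delta>. ?f c + ereal (G n c) \<le> ?f x + ereal (G n x)"
      using lsc_attains_inf[OF _ compact_cball] by blast
    then show ?thesis using m by (intro bexI[of _ c]) simp_all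
  qed
  then obtain c where c: "\<And>n. c n \<in> cball p \<delta>"
      "\<And>n x. x \<in> cball p \<delta> \<Longrightarrow> f (c n) + ereal (G n (c n)) \<le> f x + ereal (G n x)" by metis
  have lowc: "ereal (r - E * norm (c n - p) - A * (norm (c n - p))\<^sup>2) \<le> f (c n)" for n
    using low c(1)[of n] by (simp add: dist_commute)
  have cp: "f (c n) + ereal (G n (c n)) \<le> ereal (r + E * e n)" for n
    using c(2)[of p n] \<delta> e[of n] fp by (simp add: G_def)
  define q where "q n = real_of_ereal (f (c n))" for n
  have q: "f (c n) = ereal (q n)" for n
    using lowc[of n] cp[of n] unfolding q_def by (cases "f (c n)") auto
  have cq: "q n + G n (c n) \<le> r + E * e n" "r - E * norm (c n - p) - A * (norm (c n - p))\<^sup>2 \<le> q n" for n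
    using cp[of n] lowc[of n] by (auto simp: q)
  have Gn: "E * norm (c n - p) + (A + 1) * (norm (c n - p))\<^sup>2 \<le> G n (c n)" for n
    unfolding G_def using E by (intro add_right_mono mult_left_mono) (auto simp: real_le_rsqrt)
  \<comment> \<open>Comparison with the value at \<open>p\<close>, where
    \<open>G n p = E * e n\<close>: the cusp terms cancel and the spare square remains.\<close>
  have sq: "(norm (c n - p))\<^sup>2 \<le> E * e n" for n
    using cq[of n] Gn[of n] by (simp add: algebra_simps)
  have "(\<lambda>n. E * e n) \<longlonglongrightarrow> E * 0" by (intro tendsto_intros e0)
  then have Ee: "(\<lambda>n. E * e n) \<longlonglongrightarrow> 0" by simp
  have "(\<lambda>n. (norm (c n - p))\<^sup>2) \<longlonglongrightarrow> 0"
    by (rule tendsto_sandwich[OF _ _ tendsto_const Ee]) (auto simp: sq)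
  then have "(\<lambda>n. sqrt ((norm (c n - p))\<^sup>2)) \<longlonglongrightarrow> sqrt 0" by (intro tendsto_intros)
  then have nc: "(\<lambda>n. norm (c n - p)) \<longlonglongrightarrow> 0" by simp
  then have cl: "c \<longlonglongrightarrow> p" by (simp add: tendsto_norm_zero_iff LIM_zero_iff)
  have ql: "q \<longlonglongrightarrow> r"
  proof (rule tendsto_sandwich)
    show "\<forall>\<^sub>F n in sequentially. r - E * norm (c n - p) - A * (norm (c n - p))\<^sup>2 \<le> q n" using cq by simp
    have "0 \<le> G n (c n)" for n unfolding G_def using E A by simp
    then show "\<forall>\<^sub>F n in sequentially. q n \<le> r + E * e n"
      using cq(1) by (intro always_eventually allI) (smt (verit))
    have "(\<lambda>n. r - E * norm (c n - p) - A * (norm (c n - p))\<^sup>2) \<longlonglongrightarrow> r - E * 0 - A * 0\<^sup>2"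
      by (intro tendsto_intros nc)
    then show "(\<lambda>n. r - E * norm (c n - p) - A * (norm (c n - p))\<^sup>2) \<longlonglongrightarrow> r" by simp
    have "(\<lambda>n. r + E * e n) \<longlonglongrightarrow> r + 0" by (intro tendsto_intros Ee)
    then show "(\<lambda>n. r + E * e n) \<longlonglongrightarrow> r" by simp
  qed
  have "\<forall>\<^sub>F n in sequentially. dist (c n) p < \<delta>" using cl \<delta> by (rule tendstoD)
  then obtain n0 where n0: "\<And>n. n \<ge> n0 \<Longrightarrow> dist (c n) p < \<delta>"
    unfolding eventually_sequentially by auto
  \<comment> \<open>From \<open>n0\<close> on the minimizer is interior to the ball, so it is a
    local minimizer in the whole space.\<close>
  have sub: "W n (c n) \<in> frechet_subdiff f (c n)" if n: "n \<ge> n0" for n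
  proof (rule frechet_subdiff_minimizer[OF _ dG[of n "c n"]])
    show "\<bar>f (c n)\<bar> \<noteq> \<infinity>" by (simp add: q)
    have "c n \<in> ball p \<delta>" using n0[OF n] by (simp add: dist_commute)
    then have "\<forall>\<^sub>F y in at (c n). y \<in> ball p \<delta>" by (intro eventually_at_in_open') auto
    then show "\<forall>\<^sub>F y in at (c n). f (c n) + ereal (G n (c n)) \<le> f y + ereal (G n y)"
      by eventually_elim (use c(2) in auto)
  qed
  have "bounded (range (\<lambda>n. W n (c n)))"
  proof (rule boundedI)
    fix w assume "w \<in> range (\<lambda>n. W n (c n))"
    then obtain n where n: "w = W n (c n)" by auto
    have "norm (c n - p) \<le> \<delta>" using c(1)[of n] by (simp add: dist_norm norm_minus_commute)
    then have "2 * (A + 1) * norm (c n - p) \<le> 2 * (A + 1) * \<delta>" using A by (intro mult_left_mono) auto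
    then show "norm w \<le> E + 2 * (A + 1) * \<delta>" using W[of n "c n"] n by simp
  qed
  from bounded_imp_convergent_subsequence[OF this] obtain u s where
    s: "strict_mono s" and u: "((\<lambda>n. W n (c n)) \<circ> s) \<longlonglongrightarrow> u" by blast
  define t where "t n = s (n + n0)" for n
  have ts: "strict_mono t" using s unfolding t_def strict_mono_def by auto
  have tn: "t n \<ge> n0" for n
    unfolding t_def using strict_mono_imp_increasing[OF s, of "n + n0"] by linarith
  have ut: "(\<lambda>n. W (t n) (c (t n))) \<longlonglongrightarrow> u"
    using LIMSEQ_ignore_initial_segment[OF u, of n0] by (simp add: t_def)
  have "norm u \<le> E + 2 * (A + 1) * 0"
  proof (rule LIMSEQ_le)
    show "(\<lambda>n. norm (W (t n) (c (t n)))) \<longlonglongrightarrow> norm u" by (intro tendsto_intros ut)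
    show "(\<lambda>n. E + 2 * (A + 1) * norm (c (t n) - p)) \<longlonglongrightarrow> E + 2 * (A + 1) * 0"
      using LIMSEQ_subseq_LIMSEQ[OF nc ts] by (intro tendsto_intros) (simp add: o_def)
  qed (use W in auto)
  moreover have "u \<in> limiting_subdiff f p"
    unfolding limiting_subdiff_def edom_def
  proof (intro CollectI conjI exI)
    show "f p < \<infinity>" by (simp add: fp)
    show "(\<lambda>n. c (t n)) \<longlonglongrightarrow> p" using LIMSEQ_subseq_LIMSEQ[OF cl ts] by (simp add: o_def)
    show "(\<lambda>n. f (c (t n))) \<longlonglongrightarrow> f p" using LIMSEQ_subseq_LIMSEQ[OF ql ts] by (simp add: o_def q fp)
    show "\<forall>n. W (t n) (c (t n)) \<in> frechet_subdiff f (c (t n))" using sub tn by auto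
    show "(\<lambda>n. W (t n) (c (t n))) \<longlonglongrightarrow> u" by (rule ut)
  qed
  ultimately show ?thesis by auto
qed

section \<open>The KL inequality and convergence of descent sequences\<close>

text \<open>A concave graph lies below its tangents. This converts a decrease of the function values
  into a decrease of \<phi>.\<close>

lemma desingularization_tangent_le:
  fixes \<phi> :: "real \<Rightarrow> real"
  assumes \<phi>: "desingularization \<eta> \<phi>" and r: "0 < r" "ereal r < \<eta>" and q: "0 \<le> q" "ereal q < \<eta>"
  shows "\<phi> q - \<phi> r \<le> deriv \<phi> r * (q - r)"
proof -
  let ?A = "{t. 0 \<le> t \<and> ereal t < \<eta>}"
  have cv: "convex_on ?A (\<lambda>x. - \<phi> x)" using \<phi> unfolding desingularization_def concave_on_def by blast
  have con: "connected ?A"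
    unfolding connected_iff_interval
  proof (intro ballI allI impI)
    fix x y z assume "x \<in> ?A" "y \<in> ?A" "x \<le> z" "z \<le> y"
    moreover from this have "ereal z < \<eta>" using le_less_trans[of "ereal z" "ereal y" \<eta>] by simp
    ultimately show "z \<in> ?A" by simp
  qed
  have "open {t. 0 < t \<and> ereal t < \<eta>}"
  proof -
    have "open ({0<..} \<inter> ereal -` {..<\<eta>})" by (intro open_Int open_ereal_vimage) auto
    moreover have "{0<..} \<inter> ereal -` {..<\<eta>} = {t. 0 < t \<and> ereal t < \<eta>}" by auto
    ultimately show ?thesis by simp
  qed
  then have "r \<in> interior ?A"
    using r by (intro interiorI[of "{t. 0 < t \<and> ereal t < \<eta>}"]) auto
  moreover have "(\<phi> has_field_derivative deriv \<phi> r) (at r)"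
    using \<phi> r unfolding desingularization_def by (simp add: DERIV_deriv_iff_real_differentiable)
  then have "((\<lambda>x. - \<phi> x) has_field_derivative - deriv \<phi> r) (at r within ?A)"
    by (rule has_field_derivative_at_within[OF DERIV_minus])
  ultimately have "- \<phi> q - (- \<phi> r) \<ge> - deriv \<phi> r * (q - r)"
    using q by (intro convex_on_imp_above_tangent[OF cv con]) auto
  then show ?thesis by simp
qed

text \<open>The hypothesis \<open>low\<close> takes over two customary roles: it yields a
  subgradient at \<open>z (k + 2)\<close> bounded by the steps that lead there, and it yields
  continuity of \<open>f\<close> along subsequences. The offset 2 makes both of these steps
  available for every \<open>k\<close>.\<close>

theorem KL_descent_convergent:
  fixes f :: "'a::euclidean_space \<Rightarrow> ereal" and z :: "nat \<Rightarrow> 'a" and v :: "nat \<Rightarrow> real"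
  assumes KL: "KL_function f" and lsc: "lsc_on UNIV f" and bnd: "bounded (range z)"
    and fz: "\<And>k. f (z k) = ereal (v k)" and vm: "\<And>k. m \<le> v k"
    and \<alpha>: "\<alpha> > 0" and M: "M \<ge> 0" and A: "A \<ge> 0"
    and desc: "\<And>k. v (Suc k) + \<alpha> * (norm (z (Suc k) - z k))\<^sup>2 \<le> v k"
    and low: "\<And>k c. norm (c - z (k + 2)) \<le> 1 \<Longrightarrow>
      ereal (v (k + 2) - M * (norm (z (k + 2) - z (k + 1)) + norm (z (k + 1) - z k)) * norm (c - z (k + 2))
        - A * (norm (c - z (k + 2)))\<^sup>2) \<le> f c"
  shows "convergent z"
proof -
  define D where "D k = norm (z (Suc k) - z k)" for k
  have D0: "D k \<ge> 0" for k by (simp add: D_def)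
  have low: "ereal (v (k + 2) - M * (D (k + 1) + D k) * norm (c - z (k + 2)) - A * (norm (c - z (k + 2)))\<^sup>2) \<le> f c"
    if "norm (c - z (k + 2)) \<le> 1" for k c
    using low[OF that] by (simp add: D_def)
  have desc: "v (Suc k) + \<alpha> * (D k)\<^sup>2 \<le> v k" for k using desc by (simp add: D_def)
  have "v (Suc k) \<le> v k" for k
  proof -
    have "0 \<le> \<alpha> * (D k)\<^sup>2" using \<alpha> by simp
    then show ?thesis using desc[of k] by linarith
  qed
  then have dec: "decseq v" by (rule decseq_SucI)
  obtain w where w: "v \<longlonglongrightarrow> w" "\<And>k. w \<le> v k"
    using decseq_convergent[OF dec] vm by metis
  have D: "D \<longlonglongrightarrow> 0"
  proof -
    have "(\<lambda>k. (v k - v (Suc k)) / \<alpha>) \<longlonglongrightarrow> (w - w) / \<alpha>"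
      using w(1) LIMSEQ_Suc[OF w(1)] \<alpha> by (intro tendsto_intros) auto
    then have "(\<lambda>k. (v k - v (Suc k)) / \<alpha>) \<longlonglongrightarrow> 0" by simp
    note lim = this
    have le: "(D k)\<^sup>2 \<le> (v k - v (Suc k)) / \<alpha>" for k
      using desc[of k] \<alpha> by (simp add: field_simps)
    have "(\<lambda>k. (D k)\<^sup>2) \<longlonglongrightarrow> 0"
      by (rule tendsto_sandwich[OF _ _ tendsto_const lim]) (auto simp: le)
    then have "(\<lambda>k. sqrt ((D k)\<^sup>2)) \<longlonglongrightarrow> sqrt 0" by (intro tendsto_intros)
    then show ?thesis using D0 by simp
  qed
  obtain x s where s: "strict_mono s" and x: "(z \<circ> s) \<longlonglongrightarrow> x"
    using bounded_imp_convergent_subsequence[OF bnd] by blast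
  \<comment> \<open>Rewrites the subsequence in the form \<open>t j + 2\<close> at which
    \<open>low\<close> speaks; \<open>s (j + 2) \<ge> j + 2\<close> makes the truncated subtraction
    exact.\<close>
  define t where "t j = s (j + 2) - 2" for j
  have t2: "t j + 2 = s (j + 2)" for j
    using strict_mono_imp_increasing[OF s, of "j + 2"] by (simp add: t_def)
  have xt: "(\<lambda>j. z (t j + 2)) \<longlonglongrightarrow> x"
    using LIMSEQ_ignore_initial_segment[OF x, of 2] unfolding t2 by (simp add: o_def)
  have ts: "strict_mono t"
    using s t2 unfolding strict_mono_def by (metis add_less_cancel_right)
  have vt: "(\<lambda>j. v (t j + 2)) \<longlonglongrightarrow> w"
    using LIMSEQ_subseq_LIMSEQ[OF LIMSEQ_ignore_initial_segment[OF w(1), of 2] ts] by (simp add: o_def)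
  have Dt: "(\<lambda>j. D (t j)) \<longlonglongrightarrow> 0" "(\<lambda>j. D (t j + 1)) \<longlonglongrightarrow> 0"
    using LIMSEQ_subseq_LIMSEQ[OF D ts] LIMSEQ_subseq_LIMSEQ[OF LIMSEQ_ignore_initial_segment[OF D, of 1] ts]
    by (simp_all add: o_def)
  \<comment> \<open>The slope of the cusp vanishes in the limit because \<open>D\<close> tends to 0.
    Radius 1/2 keeps \<open>c\<close> within distance 1 of the late members of the
    subsequence.\<close>
  have lowx: "ereal (w - A * (norm (c - x))\<^sup>2) \<le> f c" if c: "norm (c - x) \<le> 1/2" for c
  proof -
    have "(\<lambda>j. ereal (v (t j + 2) - M * (D (t j + 1) + D (t j)) * norm (c - z (t j + 2)) - A * (norm (c - z (t j + 2)))\<^sup>2))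
        \<longlonglongrightarrow> ereal (w - M * (0 + 0) * norm (c - x) - A * (norm (c - x))\<^sup>2)"
      by (intro tendsto_intros vt Dt xt)
    moreover have "\<forall>\<^sub>F j in sequentially. ereal (v (t j + 2) - M * (D (t j + 1) + D (t j)) * norm (c - z (t j + 2)) - A * (norm (c - z (t j + 2)))\<^sup>2) \<le> f c"
    proof -
      have "\<forall>\<^sub>F j in sequentially. dist (z (t j + 2)) x < 1/2" by (rule tendstoD[OF xt]) simp
      then show ?thesis
      proof eventually_elim
        case (elim j)
        have "norm (c - z (t j + 2)) \<le> norm (c - x) + norm (x - z (t j + 2))"
          by (rule norm_triangle_sub[of _ "c - x", simplified, THEN order_trans]) simp
        then have "norm (c - z (t j + 2)) \<le> 1"
          using elim c by (simp add: dist_norm norm_minus_commute)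
        then show ?case by (rule low)
      qed
    qed
    ultimately have "ereal (w - M * (0 + 0) * norm (c - x) - A * (norm (c - x))\<^sup>2) \<le> f c"
      by (rule tendsto_upperbound) simp
    then show ?thesis by simp
  qed
  have fx: "f x = ereal w"
  proof (rule antisym)
    show "ereal w \<le> f x" using lowx[of x] by simp
    show "f x \<le> ereal w"
    proof (rule ccontr)
      assume "\<not> f x \<le> ereal w"
      then have "ereal w < f x" by simp
      from ereal_dense2[OF this] obtain a where a: "ereal w < ereal a" "ereal a < f x" by blast
      have "\<forall>\<^sub>F y in nhds x. ereal a < f y" using lsc a(2) unfolding lsc_on_UNIV_iff by simp
      then have "\<forall>\<^sub>F j in sequentially. ereal a < f (z (t j + 2))"
        using xt by (rule eventually_compose_filterlim)
      then have "\<forall>\<^sub>F j in sequentially. a \<le> v (t j + 2)"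
        by eventually_elim (simp add: fz)
      then have "a \<le> w" by (intro tendsto_lowerbound[OF vt]) auto
      then show False using a by simp
    qed
  qed
  \<comment> \<open>With slope 0 the cusp bound makes \<open>x\<close> critical, which gives access
    to the KL property there.\<close>
  have "\<exists>u\<in>limiting_subdiff f x. norm u \<le> 0"
  proof (rule limiting_subgradient_if_approx_minimal[OF lsc fx])
    fix c assume "dist c x \<le> 1/2"
    from lowx[OF this[unfolded dist_norm]] show "ereal (w - 0 * norm (c - x) - A * (norm (c - x))\<^sup>2) \<le> f c" by simp
  qed (use A in simp_all)
  then have ne: "limiting_subdiff f x \<noteq> {}" by auto
  have "\<exists>\<eta> U \<phi>. 0 < \<eta> \<and> open U \<and> x \<in> U \<and> desingularization \<eta> \<phi> \<and>
        (\<forall>u\<in>U. f x < f u \<and> f u < f x + \<eta> \<longrightarrow>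
           1 \<le> ereal (deriv \<phi> (real_of_ereal (f u - f x))) * edist_set 0 (limiting_subdiff f u))"
    using KL[unfolded KL_function_def] ne by (elim allE[of _ x] impE) assumption+
  then obtain \<eta> U \<phi> where KL_x: "0 < \<eta> \<and> open U \<and> x \<in> U \<and> desingularization \<eta> \<phi> \<and>
        (\<forall>u\<in>U. f x < f u \<and> f u < f x + \<eta> \<longrightarrow>
           1 \<le> ereal (deriv \<phi> (real_of_ereal (f u - f x))) * edist_set 0 (limiting_subdiff f u))"
    by (elim exE) (rule that)
  have \<eta>: "0 < \<eta>" and U: "open U" "x \<in> U" and \<phi>: "desingularization \<eta> \<phi>"
    using KL_x by (simp_all only: simp_thms)
  note kl = KL_x[THEN conjunct2, THEN conjunct2, THEN conjunct2, THEN conjunct2, THEN bspec, THEN mp, OF _ conjI]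
  show ?thesis
  \<comment> \<open>If the limit value is attained, the sufficient decrease makes the sequence
    stationary. Otherwise all gaps \<open>r k\<close> are positive, as the strict inequality in the
    KL property requires.\<close>
  proof (cases "\<exists>k. v k = w")
    case True
    then obtain k where k: "v k = w" by auto
    have vj: "v j = w" if "j \<ge> k" for j
      using w(2)[of j] decseqD[OF dec that] k by simp
    have "z j = z k" if "j \<ge> k" for j
      using that
    proof (induction rule: dec_induct)
      case (step n)
      have "v n = w" "v (Suc n) = w" using vj step(1) by auto
      then have "\<alpha> * (D n)\<^sup>2 \<le> 0" using desc[of n] by simp
      then have "(D n)\<^sup>2 \<le> 0" using \<alpha> by (simp add: mult_le_0_iff)
      then have "z (Suc n) = z n" by (simp add: D_def)
      then show ?case using step(3) by (rule trans)
    qed (rule refl)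
    then have "z \<longlonglongrightarrow> z k"
      by (intro tendsto_eventually eventually_sequentiallyI[of k])
    then show ?thesis by (auto simp: convergent_def)
  next
    case False
    then have wv: "w < v k" for k using w(2)[of k] by (auto simp: order_le_less)
    define r where "r k = v k - w" for k
    have r0: "r k > 0" for k using wv by (simp add: r_def)
    have "(\<lambda>k. ereal (v k - w)) \<longlonglongrightarrow> ereal (w - w)" by (intro tendsto_intros w(1))
    then have rl: "(\<lambda>k. ereal (r k)) \<longlonglongrightarrow> 0" unfolding r_def by (simp add: zero_ereal_def)
    have "\<forall>\<^sub>F k in sequentially. ereal (r k) < \<eta>" using rl \<eta> by (rule order_tendstoD)
    then obtain K0 where K0: "\<And>k. k \<ge> K0 \<Longrightarrow> ereal (r k) < \<eta>" unfolding eventually_sequentially by auto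
    obtain \<epsilon>0 where \<epsilon>0: "\<epsilon>0 > 0" "ball x \<epsilon>0 \<subseteq> U" using U by (meson open_contains_ball)
    have \<phi>0: "0 \<le> \<phi> (r k)" if "k \<ge> K0" for k
      using \<phi> r0[of k] K0[OF that] unfolding desingularization_def by auto
    \<comment> \<open>The weights come from \<open>D (k + 2) \<le> (D (k + 1) + D k) / 4 + (M /
      \<alpha>) * \<Delta>\<close>: half of \<open>D (k + 2)\<close> is stored in
      \<open>P (Suc k)\<close>, and the other half is the gain stated in
      \<open>decr\<close>.\<close>
    define P where "P k = (M / \<alpha>) * \<phi> (r (k + 2)) + D (k + 1) / 2 + D k / 4" for k
    have P0: "P k \<ge> 0" if "k \<ge> K0" for k
      using \<phi>0[of "k + 2"] that M \<alpha> D0 unfolding P_def by (intro add_nonneg_nonneg) auto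
    have decr: "P (Suc k) + D (k + 2) / 2 \<le> P k" if k: "k \<ge> K0" and zk: "z (k + 2) \<in> ball x \<epsilon>0" for k
    proof -
      define S where "S = D (k + 1) + D k"
      have S0: "S \<ge> 0" using D0 by (simp add: S_def)
      define \<phi>' where "\<phi>' = deriv \<phi> (r (k + 2))"
      have k': "k + 2 \<ge> K0" "Suc k + 2 \<ge> K0" using k by auto
      have "\<exists>u\<in>limiting_subdiff f (z (k + 2)). norm u \<le> M * S"
      proof (rule limiting_subgradient_if_approx_minimal[OF lsc fz zero_less_one _ A])
        show "0 \<le> M * S" using M S0 by simp
        fix c assume "dist c (z (k + 2)) \<le> 1"
        from low[OF this[unfolded dist_norm]]
        show "ereal (v (k + 2) - M * S * norm (c - z (k + 2)) - A * (norm (c - z (k + 2)))\<^sup>2) \<le> f c"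
          by (simp only: S_def)
      qed
      then obtain u where u: "u \<in> limiting_subdiff f (z (k + 2))" "norm u \<le> M * S" by blast
      have "edist_set 0 (limiting_subdiff f (z (k + 2))) \<le> ereal (dist 0 u)"
        unfolding edist_set_def using u(1) by (rule INF_lower)
      also have "\<dots> \<le> ereal (M * S)" using u(2) by simp
      finally have e: "edist_set 0 (limiting_subdiff f (z (k + 2))) \<le> ereal (M * S)" .
      have \<phi>'0: "\<phi>' > 0"
        unfolding \<phi>'_def
        by (rule \<phi>[unfolded desingularization_def, THEN conjunct2, THEN conjunct2, THEN conjunct2,
              THEN conjunct2, THEN conjunct2, THEN conjunct2, rule_format, OF conjI[OF r0 K0[OF k'(1)]]])
      have "1 \<le> ereal (deriv \<phi> (real_of_ereal (f (z (k + 2)) - f x))) * edist_set 0 (limiting_subdiff f (z (k + 2)))"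
      proof (rule kl)
        show "z (k + 2) \<in> U" using zk \<epsilon>0 by blast
        show "f x < f (z (k + 2))" using wv by (simp add: fx fz)
        have "ereal w + ereal (r (k + 2)) < ereal w + \<eta>" using K0[OF k'(1)] by (cases \<eta>) auto
        then show "f (z (k + 2)) < f x + \<eta>" by (simp add: fx fz r_def)
      qed
      also have "deriv \<phi> (real_of_ereal (f (z (k + 2)) - f x)) = \<phi>'"
        by (simp add: fx fz \<phi>'_def r_def)
      also have "ereal \<phi>' * edist_set 0 (limiting_subdiff f (z (k + 2))) \<le> ereal \<phi>' * ereal (M * S)"
        using \<phi>'0 e by (intro ereal_mult_left_mono) auto
      finally have kl': "1 \<le> \<phi>' * (M * S)" by simp
      have "\<phi> (r (Suc k + 2)) - \<phi> (r (k + 2)) \<le> \<phi>' * (r (Suc k + 2) - r (k + 2))"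
        unfolding \<phi>'_def by (rule desingularization_tangent_le[OF \<phi> r0 K0[OF k'(1)] less_imp_le[OF r0] K0[OF k'(2)]])
      moreover have "\<phi>' * (r (Suc k + 2) - r (k + 2)) \<le> \<phi>' * (- (\<alpha> * (D (k + 2))\<^sup>2))"
        using \<phi>'0 desc[of "k + 2"] by (intro mult_left_mono) (auto simp: r_def)
      ultimately have ph: "\<phi>' * (\<alpha> * (D (k + 2))\<^sup>2) \<le> \<phi> (r (k + 2)) - \<phi> (r (Suc k + 2))" by simp
      define \<Delta> where "\<Delta> = \<phi> (r (k + 2)) - \<phi> (r (Suc k + 2))"
      have "\<phi>' * (\<alpha> * (D (k + 2))\<^sup>2) \<ge> 0" using \<phi>'0 \<alpha> by simp
      then have \<Delta>0: "\<Delta> \<ge> 0" using ph by (simp add: \<Delta>_def)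
      \<comment> \<open>Inserting the factor \<open>\<phi>' * (M * S)\<close>, which is at least 1
        by the KL inequality, trades the unknown derivative for the decrease \<Delta> of
        \<phi>.\<close>
      have "\<alpha> * (D (k + 2))\<^sup>2 \<le> (\<phi>' * (M * S)) * (\<alpha> * (D (k + 2))\<^sup>2)"
        using mult_right_mono[OF kl', of "\<alpha> * (D (k + 2))\<^sup>2"] \<alpha> by simp
      also have "\<dots> = (\<phi>' * (\<alpha> * (D (k + 2))\<^sup>2)) * (M * S)" by (simp add: mult_ac)
      also have "\<dots> \<le> \<Delta> * (M * S)"
        using ph M S0 by (intro mult_right_mono) (auto simp: \<Delta>_def)
      finally have sq: "(D (k + 2))\<^sup>2 \<le> S * (M / \<alpha> * \<Delta>)"
        using \<alpha> by (simp add: field_simps)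
      define T where "T = M / \<alpha> * \<Delta>"
      have T0: "T \<ge> 0" using M \<alpha> \<Delta>0 by (simp add: T_def)
      \<comment> \<open>AM-GM: weight 1/4 on the two previous steps is what the potential \<open>P\<close> can absorb\<close>
      have "S * T \<le> (S / 4 + T)\<^sup>2"
      proof -
        have "0 \<le> (S / 4 - T)\<^sup>2" by simp
        then show ?thesis by (simp add: power2_eq_square algebra_simps)
      qed
      then have "(D (k + 2))\<^sup>2 \<le> (S / 4 + T)\<^sup>2" using sq by (simp add: T_def)
      then have "D (k + 2) \<le> S / 4 + T"
        by (rule power2_le_imp_le) (use S0 T0 in simp)
      moreover have "T = M / \<alpha> * \<phi> (r (k + 2)) - M / \<alpha> * \<phi> (r (Suc k + 2))"
        by (simp add: T_def \<Delta>_def right_diff_distrib)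
      ultimately show ?thesis unfolding P_def S_def by (simp add: field_simps)
    qed
    \<comment> \<open>In one step the distance grows by at most \<open>D (k + 2)\<close> while
      \<open>P\<close> loses at least half of that; hence the factor 2.\<close>
    define Q where "Q k = dist (z (k + 2)) x + 2 * P k" for k
    have \<phi>l: "(\<lambda>k. \<phi> (r k)) \<longlonglongrightarrow> 0"
    proof -
      have c: "continuous_on {t. 0 \<le> t \<and> ereal t < \<eta>} \<phi>" "\<phi> 0 = 0"
        using \<phi> unfolding desingularization_def by auto
      have "(\<lambda>k. \<phi> (r (k + K0))) \<longlonglongrightarrow> \<phi> 0"
      proof (rule continuous_on_tendsto_compose[OF c(1)])
        show "(\<lambda>k. r (k + K0)) \<longlonglongrightarrow> 0"
          using rl LIMSEQ_ignore_initial_segment[of r 0 K0] by (simp add: zero_ereal_def)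
      qed (use \<eta> r0 K0 in \<open>auto simp: zero_ereal_def less_imp_le\<close>)
      then show ?thesis using c(2) LIMSEQ_offset by fastforce
    qed
    have Ql: "(\<lambda>j. Q (t j)) \<longlonglongrightarrow> 0"
    proof -
      have "(\<lambda>j. \<phi> (r (t j + 2))) \<longlonglongrightarrow> 0"
        using LIMSEQ_subseq_LIMSEQ[OF LIMSEQ_ignore_initial_segment[OF \<phi>l, of 2] ts] by (simp add: o_def)
      then have "(\<lambda>j. Q (t j)) \<longlonglongrightarrow> dist x x + 2 * ((M / \<alpha>) * 0 + 0 / 2 + 0 / 4)"
        unfolding Q_def P_def using Dt xt \<alpha> by (intro tendsto_intros) auto
      then show ?thesis by simp
    qed
    have "z \<longlonglongrightarrow> x"
    proof (rule metric_LIMSEQ_I)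
      fix \<epsilon> :: real assume "\<epsilon> > 0"
      define \<epsilon>1 where "\<epsilon>1 = min \<epsilon> \<epsilon>0"
      have "\<epsilon>1 > 0" using \<open>\<epsilon> > 0\<close> \<epsilon>0 by (simp add: \<epsilon>1_def)
      have "\<forall>\<^sub>F j in sequentially. Q (t j) < \<epsilon>1" using Ql \<open>\<epsilon>1 > 0\<close> by (rule order_tendstoD)
      then have "\<forall>\<^sub>F j in sequentially. Q (t j) < \<epsilon>1 \<and> j \<ge> K0"
        using eventually_ge_at_top by (rule eventually_conj)
      then obtain j where j: "Q (t j) < \<epsilon>1" "j \<ge> K0" by (auto dest: eventually_happens)
      have tj: "t j \<ge> K0" using strict_mono_imp_increasing[OF ts, of j] j(2) by simp
      \<comment> \<open>Trapping: \<open>Q k < \<epsilon>1\<close> puts \<open>z (k + 2)\<close>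
        into the ball where the KL inequality holds, and that inequality gives
        \<open>Q (Suc k) \<le> Q k\<close>.\<close>
      have Qk: "Q k < \<epsilon>1" if "k \<ge> t j" for k
        using that
      proof (induction rule: dec_induct)
        case (step k)
        have k: "K0 \<le> k" using tj step(1) by (rule le_trans)
        have "dist (z (k + 2)) x < \<epsilon>0"
          using step(3) P0[OF k] unfolding Q_def \<epsilon>1_def by linarith
        then have "z (k + 2) \<in> ball x \<epsilon>0" by (simp add: dist_commute)
        then have "P (Suc k) + D (k + 2) / 2 \<le> P k" by (rule decr[OF k])
        moreover have "dist (z (Suc k + 2)) x \<le> D (k + 2) + dist (z (k + 2)) x"
          using dist_triangle[of "z (Suc k + 2)" x "z (k + 2)"] unfolding D_def dist_norm by simp
        ultimately show ?case using step(3) unfolding Q_def by linarith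
      qed (rule j(1))
      show "\<exists>n0. \<forall>n\<ge>n0. dist (z n) x < \<epsilon>"
      proof (intro exI[of _ "t j + 2"] allI impI)
        fix n assume n: "n \<ge> t j + 2"
        define k where "k = n - 2"
        have k: "n = k + 2" "k \<ge> t j" using n by (auto simp: k_def)
        have "0 \<le> P k" using tj k(2) by (intro P0) (rule le_trans)
        then show "dist (z n) x < \<epsilon>" using Qk[OF k(2)] unfolding Q_def \<epsilon>1_def k(1) by linarith
      qed
    qed
    then show ?thesis by (auto simp: convergent_def)
  qed
qed

section \<open>Norms given as functions on a Euclidean space\<close>

text \<open>The upper bound comes from expansion in the basis and makes \<open>n\<close> continuous;
  the lower constant is then the minimum of \<open>n\<close> on the unit sphere.\<close>

lemma norm_on_equivalent:
  fixes n :: "'a::euclidean_space \<Rightarrow> real"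
  assumes n: "norm_on UNIV n"
  obtains c C where "c > 0" "C > 0" "\<And>x. c * norm x \<le> n x" "\<And>x. n x \<le> C * norm x"
proof -
  have n0: "n x \<ge> 0" "n x = 0 \<longleftrightarrow> x = 0" and nm: "n (a *\<^sub>R x) = \<bar>a\<bar> * n x" and nt: "n (x + y) \<le> n x + n y"
    for x y a using n unfolding norm_on_def by auto
  define C where "C = (\<Sum>b\<in>Basis. n (b::'a)) + 1"
  have C: "C > 0" unfolding C_def using sum_nonneg[of Basis n] n0(1) by (simp add: add_nonneg_pos)
  have ns: "n (sum g A) \<le> (\<Sum>a\<in>A. n (g a))" if "finite A" for g and A :: "'a set"
    using that
  proof (induction A rule: finite_induct)
    case (insert a A)
    then show ?case using nt[of "g a" "sum g A"] by simp
  qed (use n0(2)[of 0] in simp)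
  have up: "n x \<le> C * norm x" for x
  proof -
    have "n x = n (\<Sum>b\<in>Basis. (x \<bullet> b) *\<^sub>R b)" by (simp add: euclidean_representation)
    also have "\<dots> \<le> (\<Sum>b\<in>Basis. \<bar>x \<bullet> b\<bar> * n b)" using ns[of Basis "\<lambda>b. (x \<bullet> b) *\<^sub>R b"] by (simp add: nm)
    also have "\<dots> \<le> (\<Sum>b\<in>Basis. norm x * n b)"
      by (intro sum_mono mult_right_mono Basis_le_norm n0)
    also have "\<dots> \<le> C * norm x" by (simp add: C_def sum_distrib_left algebra_simps)
    finally show ?thesis .
  qed
  have "continuous_on UNIV n"
  proof (rule continuous_onI)
    fix x :: 'a and e :: real assume e: "e > 0"
    have "dist (n y) (n x) \<le> e" if "dist y x < e / C" for y
    proof -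
      have "n y \<le> n x + n (y - x)" "n x \<le> n y + n (x - y)"
        using nt[of x "y - x"] nt[of y "x - y"] by simp_all
      moreover have "C * norm (y - x) \<le> e" using that C by (simp add: dist_norm field_simps)
      moreover have "C * norm (x - y) \<le> e" using that C by (simp add: dist_norm norm_minus_commute field_simps)
      ultimately show ?thesis using up[of "y - x"] up[of "x - y"] by (simp add: dist_real_def)
    qed
    then show "\<exists>d>0. \<forall>y\<in>UNIV. dist y x < d \<longrightarrow> dist (n y) (n x) \<le> e"
      using e C by (intro exI[of _ "e / C"]) simp
  qed
  then have "continuous_on (sphere 0 1) n" by (rule continuous_on_subset) simp
  moreover have "sphere (0::'a) 1 \<noteq> {}" by simp
  ultimately obtain w where w: "w \<in> sphere 0 1" "\<And>y. y \<in> sphere 0 1 \<Longrightarrow> n w \<le> n y"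
    using continuous_attains_inf[of "sphere (0::'a) 1" n] by auto
  have "w \<noteq> 0" using w(1) by auto
  then have nw: "n w > 0" using n0[of w] by simp
  have "n w * norm x \<le> n x" for x
  proof (cases "x = 0")
    case False
    then have "n w \<le> n ((1 / norm x) *\<^sub>R x)" by (intro w(2)) simp
    also have "\<dots> = n x / norm x" by (simp add: nm)
    finally show ?thesis using False by (simp add: field_simps)
  qed (simp add: n0)
  with nw C up show thesis by (intro that)
qed

lemma mcomplete_norm_on:
  fixes n :: "'a::euclidean_space \<Rightarrow> real"
  assumes n: "norm_on UNIV n"
  shows "Metric_space.mcomplete UNIV (\<lambda>u v. n (u - v))"
proof -
  have nt: "n (x + y) \<le> n x + n y" and n0: "n x \<ge> 0" "n x = 0 \<longleftrightarrow> x = 0" for x y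
    using n unfolding norm_on_def by auto
  have nm: "n (- x) = n x" for x
  proof -
    have "n ((-1) *\<^sub>R x) = \<bar>-1\<bar> * n x" using n unfolding norm_on_def by blast
    then show ?thesis by simp
  qed
  interpret Metric_space UNIV "\<lambda>u v. n (u - v)"
  proof
    show "n (x - y) = n (y - x)" for x y using nm[of "x - y"] by simp
    show "n (x - z) \<le> n (x - y) + n (y - z)" for x y z using nt[of "x - y" "y - z"] by simp
  qed (simp_all add: n0)
  obtain c C where cC: "c > 0" "C > 0" "\<And>x. c * norm x \<le> n x" "\<And>x. n x \<le> C * norm x"
    using norm_on_equivalent[OF n] by blast
  show ?thesis
    unfolding mcomplete_def
  proof (intro allI impI)
    fix \<sigma> :: "nat \<Rightarrow> 'a" assume \<sigma>: "MCauchy \<sigma>"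
    have "Cauchy \<sigma>"
    proof (rule metric_CauchyI)
      fix e :: real assume "e > 0"
      then have "c * e > 0" using cC by simp
      then have "\<exists>K. \<forall>m k. K \<le> m \<longrightarrow> K \<le> k \<longrightarrow> n (\<sigma> m - \<sigma> k) < c * e"
        using \<sigma>[unfolded MCauchy_def, THEN conjunct2, rule_format, of "c * e"] by simp
      then obtain K where K: "\<And>m k. m \<ge> K \<Longrightarrow> k \<ge> K \<Longrightarrow> n (\<sigma> m - \<sigma> k) < c * e" by blast
      have "dist (\<sigma> m) (\<sigma> k) < e" if "m \<ge> K" "k \<ge> K" for m k
      proof -
        have "c * norm (\<sigma> m - \<sigma> k) < c * e" using cC(3)[of "\<sigma> m - \<sigma> k"] K[OF that] by linarith
        then show ?thesis using cC(1) by (simp add: dist_norm)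
      qed
      then show "\<exists>K. \<forall>m\<ge>K. \<forall>k\<ge>K. dist (\<sigma> m) (\<sigma> k) < e" by blast
    qed
    then obtain x where x: "\<sigma> \<longlonglongrightarrow> x" by (auto simp: Cauchy_convergent_iff convergent_def)
    have "limitin mtopology \<sigma> x sequentially"
      unfolding limitin_metric
    proof (intro conjI allI impI)
      fix e :: real assume "e > 0"
      then have "\<forall>\<^sub>F k in sequentially. dist (\<sigma> k) x < e / C"
        using cC by (intro tendstoD[OF x]) simp
      then show "\<forall>\<^sub>F k in sequentially. \<sigma> k \<in> UNIV \<and> n (\<sigma> k - x) < e"
      proof eventually_elim
        case (elim k)
        then have "C * norm (\<sigma> k - x) < e" using cC(2) by (simp add: dist_norm field_simps)
        then show ?case using cC(4)[of "\<sigma> k - x"] by simp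
      qed
    qed simp
    then show "\<exists>x. limitin mtopology \<sigma> x sequentially" ..
  qed
qed

text \<open>The Cauchy property carries over to \<open>n\<close> by equivalence of norms. Strict
  bounds on the terms give only a weak bound on the supremum, hence the real \<open>e\<close>
  strictly between 0 and \<open>a\<close>.\<close>

lemma SUP_norm_on_tail_tendsto_zero:
  fixes z :: "nat \<Rightarrow> 'a::euclidean_space"
  assumes n: "norm_on UNIV n" and z: "convergent z"
  shows "(\<lambda>k. SUP p. ereal (n (z (k + p) - z k))) \<longlonglongrightarrow> 0"
proof (rule order_tendstoI)
  have n0: "n 0 = 0" using n unfolding norm_on_def by blast
  obtain c C where cC': "c > 0" "C > 0" "\<And>x. c * norm x \<le> n x" "\<And>x. n x \<le> C * norm x"
    using norm_on_equivalent[OF n] by blast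
  note cC = cC'(2,4)
  have nonneg: "0 \<le> (SUP p. ereal (n (z (k + p) - z k)))" for k
    by (rule SUP_upper2[of 0]) (simp_all add: n0 zero_ereal_def)
  show "\<forall>\<^sub>F k in sequentially. a < (SUP p. ereal (n (z (k + p) - z k)))" if "a < 0" for a
    by (rule always_eventually) (rule allI, rule less_le_trans[OF that nonneg])
  show "\<forall>\<^sub>F k in sequentially. (SUP p. ereal (n (z (k + p) - z k))) < a" if a: "0 < a" for a
  proof -
    obtain e where e: "0 < ereal e" "ereal e < a" using ereal_dense2[OF a] by blast
    then have "e / C > 0" using cC(1) by simp
    have "Cauchy z" using z by (simp add: Cauchy_convergent_iff)
    from metric_CauchyD[OF this \<open>e / C > 0\<close>]
    obtain K where K: "\<And>m k. m \<ge> K \<Longrightarrow> k \<ge> K \<Longrightarrow> dist (z m) (z k) < e / C" by blast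
    have "(SUP p. ereal (n (z (k + p) - z k))) < a" if k: "k \<ge> K" for k
    proof -
      have "n (z (k + p) - z k) \<le> e" for p
      proof -
        have "dist (z (k + p)) (z k) < e / C" by (rule K) (use k in simp_all)
        then have "C * norm (z (k + p) - z k) < e" using cC(1) by (simp add: dist_norm field_simps)
        then show ?thesis using cC(2)[of "z (k + p) - z k"] by simp
      qed
      then have "(SUP p. ereal (n (z (k + p) - z k))) \<le> ereal e" by (intro SUP_least) simp
      then show ?thesis using e(2) by (rule le_less_trans)
    qed
    then show ?thesis by (intro eventually_sequentiallyI[of K])
  qed
qed

section \<open>Block decomposition and the product norm\<close>

lemma subspace_block_space: "subspace (block_space b i)"
  unfolding subspace_def block_space_def by auto

lemma block_part_in_block_space [simp]: "block_part b i x \<in> block_space b i"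
  unfolding block_space_def block_part_def by auto

lemma block_part_add: "block_part b i (x + y) = block_part b i x + block_part b i y"
  and block_part_diff: "block_part b i (x - y) = block_part b i x - block_part b i y"
  and block_part_scaleR: "block_part b i (a *\<^sub>R x) = a *\<^sub>R block_part b i x"
  and block_part_0 [simp]: "block_part b i 0 = 0"
  unfolding block_part_def by (auto simp: vec_eq_iff)

lemma block_part_ident: "x \<in> block_space b i \<Longrightarrow> block_part b i x = x"
  unfolding block_space_def block_part_def by (auto simp: vec_eq_iff)

lemma block_part_block_part [simp]: "block_part b j (block_part b i x) = (if i = j then block_part b i x else 0)"
  unfolding block_part_def by (auto simp: vec_eq_iff)

lemma bounded_linear_block_part: "bounded_linear (block_part b i)"
  by (simp add: linear_conv_bounded_linear[symmetric] linearI block_part_add block_part_scaleR)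

lemma inner_block_part: "block_part b i x \<bullet> y = x \<bullet> block_part b i y"
  unfolding block_part_def inner_vec_def by (intro sum.cong) auto

lemma norm_block_part_le: "norm (block_part b i x) \<le> norm x"
proof -
  have "(norm (block_part b i x))\<^sup>2 = x \<bullet> block_part b i x"
    by (simp add: power2_norm_eq_inner inner_block_part)
  also have "\<dots> \<le> norm x * norm (block_part b i x)" by (rule norm_cauchy_schwarz)
  finally show ?thesis by (cases "block_part b i x = 0") (simp_all add: power2_eq_square)
qed

lemma sum_block_part:
  assumes "is_block_map b N"
  shows "(\<Sum>i=1..N. block_part b i x) = x"
proof -
  have "b j \<in> {1..N}" for j using assms unfolding is_block_map_def by auto
  then show ?thesis by (simp add: vec_eq_iff block_part_def)
qed

lemma norm_on_prod_norm:
  assumes b: "is_block_map b N" and nd: "\<And>i. i \<in> {1..N} \<Longrightarrow> norm_on (block_space b i) (nd i)"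
  shows "norm_on UNIV (prod_norm b N nd)"
proof -
  have p: "0 \<le> nd i (block_part b i x)" "nd i (block_part b i x) = 0 \<longleftrightarrow> block_part b i x = 0"
      "nd i (a *\<^sub>R block_part b i x) = \<bar>a\<bar> * nd i (block_part b i x)"
      "nd i (block_part b i x + block_part b i y) \<le> nd i (block_part b i x) + nd i (block_part b i y)"
    if "i \<in> {1..N}" for i x y a using nd[OF that] unfolding norm_on_def by auto
  show ?thesis
    unfolding norm_on_def prod_norm_def
  proof (intro conjI ballI allI)
    fix x y and a :: real
    show "0 \<le> (\<Sum>i=1..N. nd i (block_part b i x))" by (intro sum_nonneg p)
    have "(\<Sum>i=1..N. nd i (block_part b i x)) = 0 \<longleftrightarrow> (\<forall>i\<in>{1..N}. block_part b i x = 0)"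
      using sum_nonneg_eq_0_iff[of "{1..N}" "\<lambda>i. nd i (block_part b i x)"] p(1,2) by auto
    also have "\<dots> \<longleftrightarrow> x = 0"
    proof
      assume "\<forall>i\<in>{1..N}. block_part b i x = 0"
      then have "(\<Sum>i=1..N. block_part b i x) = 0" by (intro sum.neutral)
      then show "x = 0" using sum_block_part[OF b] by metis
    qed simp
    finally show "((\<Sum>i=1..N. nd i (block_part b i x)) = 0) = (x = 0)" .
    show "(\<Sum>i=1..N. nd i (block_part b i (a *\<^sub>R x))) = \<bar>a\<bar> * (\<Sum>i=1..N. nd i (block_part b i x))"
      using p(3) by (simp add: block_part_scaleR sum_distrib_left)
    have "(\<Sum>i=1..N. nd i (block_part b i (x + y))) \<le> (\<Sum>i=1..N. nd i (block_part b i x) + nd i (block_part b i y))"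
      unfolding block_part_add by (intro sum_mono p)
    then show "(\<Sum>i=1..N. nd i (block_part b i (x + y)))
        \<le> (\<Sum>i=1..N. nd i (block_part b i x)) + (\<Sum>i=1..N. nd i (block_part b i y))"
      by (simp add: sum.distrib)
  qed
qed

text \<open>Lets the equivalence constants of the product norm be used for the norm of each single
  block.\<close>

lemma prod_norm_block:
  assumes nd: "\<And>i. i \<in> {1..N} \<Longrightarrow> norm_on (block_space b i) (nd i)"
    and i: "i \<in> {1..N}" and v: "v \<in> block_space b i"
  shows "prod_norm b N nd v = nd i v"
proof -
  have "nd j 0 = 0" if "j \<in> {1..N}" for j
    using nd[OF that] subspace_0[OF subspace_block_space] unfolding norm_on_def by blast
  then have "nd j (block_part b j v) = (if j = i then nd i v else 0)" if "j \<in> {1..N}" for j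
    using that block_part_ident[OF v] block_part_block_part[of b j i v] by auto
  then show ?thesis using i unfolding prod_norm_def by simp
qed

section \<open>Gradients on subspaces\<close>

text \<open>A derivative within \<open>V\<close> is determined along lines in directions of
  \<open>V\<close>. Two candidate gradients lie in \<open>V\<close>, so their difference is such a
  direction and is orthogonal to itself.\<close>

lemma gradient_on_eqI:
  assumes V: "subspace V" and x: "x \<in> V" and D: "D \<in> V"
    and f: "(f has_derivative (\<lambda>h. h \<bullet> D)) (at x within V)"
  shows "gradient_on V f x = D"
  unfolding gradient_on_def
proof (rule the_equality)
  show "D \<in> V \<and> (f has_derivative (\<lambda>h. h \<bullet> D)) (at x within V)" using D f by simp
  fix D' assume D': "D' \<in> V \<and> (f has_derivative (\<lambda>h. h \<bullet> D')) (at x within V)"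
  have line: "((\<lambda>t. f (x + t *\<^sub>R k)) has_real_derivative k \<bullet> E) (at 0)"
    if k: "k \<in> V" and E: "(f has_derivative (\<lambda>h. h \<bullet> E)) (at x within V)" for k E
  proof -
    have img: "range (\<lambda>t. x + t *\<^sub>R k) \<subseteq> V"
      using V x k by (auto intro: subspace_add subspace_scale)
    have "((\<lambda>t. t *\<^sub>R k) has_derivative (\<lambda>t. t *\<^sub>R k)) (at 0)"
      by (rule bounded_linear_imp_has_derivative[OF bounded_linear_scaleR_left])
    then have d: "((\<lambda>t. x + t *\<^sub>R k) has_derivative (\<lambda>t. t *\<^sub>R k)) (at 0)"
      using has_derivative_add[OF has_derivative_const] by force
    have "(f has_derivative (\<lambda>h. h \<bullet> E)) (at (x + 0 *\<^sub>R k) within range (\<lambda>t. x + t *\<^sub>R k))"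
      using has_derivative_subset[OF E img] by simp
    from has_derivative_in_compose[OF d this]
    have "((\<lambda>t. f (x + t *\<^sub>R k)) has_derivative (\<lambda>t. (t *\<^sub>R k) \<bullet> E)) (at 0)" .
    then show ?thesis unfolding has_field_derivative_def by (simp add: mult_commute_abs)
  qed
  have "D' - D \<in> V" using V D D' by (simp add: subspace_diff)
  then have "(D' - D) \<bullet> D' = (D' - D) \<bullet> D"
    using DERIV_unique[OF line[of "D' - D" D'] line[of "D' - D" D]] D' f by simp
  then have "(D' - D) \<bullet> (D' - D) = 0" by (simp add: inner_diff_right)
  then show "D' = D" by simp
qed

lemma has_derivative_gradient:
  fixes H :: "'a::euclidean_space \<Rightarrow> real"
  assumes "H differentiable (at x)"
  shows "(H has_derivative (\<lambda>h. h \<bullet> gradient H x)) (at x)"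
proof -
  obtain H' where H': "(H has_derivative H') (at x)" using assms unfolding differentiable_def by blast
  then have lin: "linear H'" by (rule has_derivative_linear)
  define D where "D = (\<Sum>b\<in>Basis. H' b *\<^sub>R b)"
  have "H' = (\<lambda>h. h \<bullet> D)"
  proof
    fix h
    have "H' h = H' (\<Sum>b\<in>Basis. (h \<bullet> b) *\<^sub>R b)" by (simp add: euclidean_representation)
    also have "\<dots> = (\<Sum>b\<in>Basis. (h \<bullet> b) * H' b)"
      using lin by (simp add: linear_sum linear_scale)
    also have "\<dots> = h \<bullet> D" by (simp add: D_def inner_sum_right mult.commute)
    finally show "H' h = h \<bullet> D" .
  qed
  then have "(H has_derivative (\<lambda>h. h \<bullet> D)) (at x)" using H' by simp
  moreover from this have "gradient H x = D" by (intro gradient_on_eqI) auto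
  ultimately show ?thesis by simp
qed

lemma splice_eq: "splice b i u c v = splice b i u 0 v + block_part b i c"
  unfolding splice_def block_part_def by (auto simp: vec_eq_iff)

lemma gradient_on_block:
  fixes H :: "real^'n::finite \<Rightarrow> real"
  assumes H: "\<And>x. H differentiable (at x)" and c: "c \<in> block_space b i"
  shows "gradient_on (block_space b i) (\<lambda>c. H (splice b i u c v)) c = block_part b i (gradient H (splice b i u c v))"
proof (rule gradient_on_eqI[OF subspace_block_space c block_part_in_block_space])
  have "((\<lambda>c. splice b i u 0 v + block_part b i c) has_derivative (\<lambda>h. 0 + block_part b i h)) (at c within block_space b i)"
    by (rule has_derivative_add[OF has_derivative_const
          bounded_linear_imp_has_derivative[OF bounded_linear_block_part]])
  then have "((\<lambda>c. splice b i u c v) has_derivative (\<lambda>h. block_part b i h)) (at c within block_space b i)"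
    by (simp add: splice_eq[of b i u _ v, symmetric])
  from has_derivative_compose[OF this has_derivative_gradient[OF H]]
  have "((\<lambda>c. H (splice b i u c v)) has_derivative (\<lambda>h. block_part b i h \<bullet> gradient H (splice b i u c v))) (at c within block_space b i)" .
  then show "((\<lambda>c. H (splice b i u c v)) has_derivative (\<lambda>h. h \<bullet> block_part b i (gradient H (splice b i u c v)))) (at c within block_space b i)"
    by (simp add: inner_block_part)
qed

section \<open>Inner products and metrics on a block\<close>

text \<open>Positive definiteness makes \<open>R\<close> a bijection of \<open>V\<close>, so the
  weight cancels against its inverse: the inner product chosen by the algorithm affects neither the
  majorization nor the subproblem.\<close>

lemma weighted_inner_inv_into:
  fixes R :: "'a::euclidean_space \<Rightarrow> 'a"
  assumes V: "subspace V" and R: "spd_on V R" and g: "g \<in> V"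
  shows "weighted_inner R (inv_into V R g) v = g \<bullet> v"
proof -
  have lin: "linear R" and sub: "R ` V \<subseteq> V" and pos: "\<And>u. u \<in> V \<Longrightarrow> u \<noteq> 0 \<Longrightarrow> 0 < R u \<bullet> u"
    using R unfolding spd_on_def by auto
  have "inj_on R V"
  proof (rule inj_onI)
    fix x y assume "x \<in> V" "y \<in> V" "R x = R y"
    then have "x - y \<in> V" "R (x - y) = 0" using V lin by (auto simp: subspace_diff linear_diff)
    then show "x = y" using pos[of "x - y"] by (cases "x - y = 0") auto
  qed
  then have "inj_on R (span V)" using V by (simp add: span_eq_iff[THEN iffD2])
  then have "dim (R ` V) = dim V" by (rule dim_image_eq[OF lin])
  then have "R ` V = V"
    by (intro subspace_dim_equal linear_subspace_image lin V sub) simp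
  then have "R (inv_into V R g) = g" using g by (intro f_inv_into_f) simp
  then show ?thesis by (simp add: weighted_inner_def)
qed

text \<open>Convexity turns the bound (B3) into a Lipschitz bound near the diagonal: \<open>u\<close> lies on the segment
  from \<open>v\<close> to a point at distance 1 from \<open>v\<close>.\<close>

lemma admissible_metrics_le:
  fixes V :: "'a::euclidean_space set"
  assumes V: "subspace V" and adm: "admissible_metrics V nd \<D>" 
  obtains M where "M \<ge> 0"
    "\<And>d u v. d \<in> \<D> \<Longrightarrow> u \<in> V \<Longrightarrow> v \<in> V \<Longrightarrow> norm u \<le> r \<Longrightarrow> norm v \<le> r \<Longrightarrow> d u v \<le> M * norm (u - v)"
proof -
  \<comment> \<open>The radius leaves room for the endpoint \<open>w\<close> of the prolonged
    segment, which is 1 away from \<open>v\<close>.\<close>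
  define K where "K = cball 0 (r + 1) \<inter> V"
  have "compact K" unfolding K_def by (intro compact_Int_closed closed_subspace V) auto
  then have KK: "compact (K \<times> K) \<and> K \<times> K \<subseteq> V \<times> V" unfolding K_def by (auto intro: compact_Times)
  have "\<forall>K. compact K \<and> K \<subseteq> V \<times> V \<longrightarrow> (\<exists>M::real. \<forall>(x, y)\<in>K. \<bar>metric_sup \<D> x y\<bar> \<le> ereal M)"
    using adm unfolding admissible_metrics_def by (elim conjE)
  from this[THEN spec, THEN mp, OF KK]
  obtain M where M: "\<And>x y. x \<in> K \<Longrightarrow> y \<in> K \<Longrightarrow> \<bar>metric_sup \<D> x y\<bar> \<le> ereal M" by auto
  have dM: "d x y \<le> M" if "d \<in> \<D>" "x \<in> K" "y \<in> K" for d x y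
  proof -
    have "ereal (d x y) \<le> metric_sup \<D> x y" unfolding metric_sup_def using that(1) by (rule SUP_upper)
    also have "\<dots> \<le> \<bar>metric_sup \<D> x y\<bar>" by (cases "metric_sup \<D> x y") auto
    also have "\<dots> \<le> ereal M" using that(2,3) by (rule M)
    finally show ?thesis by simp
  qed
  show thesis
  proof (rule that[of "max M 0"])
    fix d u v assume d: "d \<in> \<D>" and u: "u \<in> V" "norm u \<le> r" and v: "v \<in> V" "norm v \<le> r"
    interpret Metric_space V d using adm d unfolding admissible_metrics_def by blast
    have cv: "convex_on V (\<lambda>x. d x v)" using adm d v unfolding admissible_metrics_def by blast
    have uK: "u \<in> K" "v \<in> K" using u v by (auto simp: K_def)
    show "d u v \<le> max M 0 * norm (u - v)"
    \<comment> \<open>At distance at least 1 the plain bound on the metric is already a Lipschitz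
      bound.\<close>
    proof (cases "norm (u - v) < 1")
      case False
      then have "max M 0 * 1 \<le> max M 0 * norm (u - v)" by (intro mult_left_mono) auto
      then show ?thesis using dM[OF d uK] by simp
    next
      case True
      show ?thesis
      proof (cases "u = v")
        case True
        then show ?thesis using v by simp
      next
        case False
        define t where "t = norm (u - v)"
        have t: "0 < t" "t \<le> 1" using False True by (auto simp: t_def)
        define w where "w = v + (1 / t) *\<^sub>R (u - v)"
        have wV: "w \<in> V" unfolding w_def using V u v by (intro subspace_add subspace_scale subspace_diff)
        have "norm w \<le> norm v + norm ((1 / t) *\<^sub>R (u - v))" unfolding w_def by (rule norm_triangle_ineq)
        also have "norm ((1 / t) *\<^sub>R (u - v)) = 1" using t by (simp add: t_def)
        finally have wK: "w \<in> K" using v wV by (simp add: K_def)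
        have "t *\<^sub>R w = t *\<^sub>R v + (u - v)" using t by (simp add: w_def scaleR_add_right)
        then have eq: "(1 - t) *\<^sub>R v + t *\<^sub>R w = u" by (simp add: scaleR_diff_left)
        have "d u v \<le> (1 - t) * d v v + t * d w v"
          using convex_onD[OF cv less_imp_le[OF t(1)] t(2) v(1) wV] unfolding eq .
        also have "d v v = 0" using v by simp
        also have "(1 - t) * 0 + t * d w v \<le> t * max M 0"
          using mult_left_mono[of "d w v" "max M 0" t] dM[OF d wK uK(2)] t(1) by simp
        finally show ?thesis by (simp add: t_def mult.commute)
      qed
    qed
  qed simp
qed

section \<open>Lower semicontinuity of the objective\<close>

lemma sum_not_MInfty:
  fixes f :: "'i \<Rightarrow> ereal"
  assumes "finite I" "\<And>i. i \<in> I \<Longrightarrow> f i \<noteq> -\<infinity>"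
  shows "sum f I \<noteq> -\<infinity>"
  using assms by (induction I rule: finite_induct) (auto simp: ereal_plus_eq_MInfty)

lemma lsc_on_sum:
  fixes f :: "'i \<Rightarrow> 'a::topological_space \<Rightarrow> ereal"
  assumes "finite I" "\<And>i. i \<in> I \<Longrightarrow> lsc_on UNIV (f i)" "\<And>i x. i \<in> I \<Longrightarrow> f i x \<noteq> -\<infinity>"
  shows "lsc_on UNIV (\<lambda>x. \<Sum>i\<in>I. f i x)"
  using assms
proof (induction I rule: finite_induct)
  case empty
  then show ?case using lsc_on_ereal[of "\<lambda>x. 0"] by (simp add: zero_ereal_def)
next
  case (insert j I)
  have "(\<Sum>i\<in>I. f i x) \<noteq> -\<infinity>" for x
    using insert.prems(2) insert.hyps(1) by (intro sum_not_MInfty) auto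
  then show ?case using insert by (simp add: lsc_on_add)
qed

lemma lsc_on_compose_block_part:
  fixes F :: "real^'n::finite \<Rightarrow> ereal"
  assumes "lsc_on (block_space b i) F"
  shows "lsc_on UNIV (\<lambda>x. F (block_part b i x))"
  unfolding lsc_on_UNIV_iff
proof (intro allI impI)
  fix x a assume a: "a < F (block_part b i x)"
  have "F (block_part b i x) \<le> Liminf (at (block_part b i x) within block_space b i) F"
    using assms unfolding lsc_on_def by (rule bspec) simp
  then have "\<forall>\<^sub>F y in at (block_part b i x) within block_space b i. a < F y"
    using a less_LiminfD less_le_trans by blast
  then have "\<forall>\<^sub>F y in nhds (block_part b i x). y \<in> block_space b i \<longrightarrow> a < F y"
    unfolding eventually_at_filter by eventually_elim (use a in auto)
  moreover have "filterlim (block_part b i) (nhds (block_part b i x)) (nhds x)"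
    using linear_continuous_at[OF bounded_linear_block_part[of b i], of x]
    by (simp add: isCont_def tendsto_at_iff_tendsto_nhds)
  ultimately have "\<forall>\<^sub>F y in nhds x. block_part b i y \<in> block_space b i \<longrightarrow> a < F (block_part b i y)"
    by (rule eventually_compose_filterlim)
  then show "\<forall>\<^sub>F y in nhds x. a < F (block_part b i y)" by simp
qed

lemma lsc_on_objective:
  assumes "assumption_A1 b N H" "assumption_A2 b N F"
  shows "lsc_on UNIV (objective b N H F)"
proof -
  have F: "lsc_on (block_space b i) (F i)" "\<And>x. x \<in> block_space b i \<Longrightarrow> F i x \<noteq> -\<infinity>" if "i \<in> {1..N}" for i
    using assms(2) that unfolding assumption_A2_def proper_on_def by auto
  have "continuous_on UNIV H"
    using assms(1) unfolding assumption_A1_def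
    by (intro differentiable_imp_continuous_on) (auto simp: differentiable_on_def differentiable_at_withinI)
  moreover have "(\<Sum>i=1..N. F i (block_part b i x)) \<noteq> -\<infinity>" for x
    using F(2) by (intro sum_not_MInfty) auto
  ultimately show ?thesis
    unfolding objective_def[abs_def]
    by (intro lsc_on_add lsc_on_ereal lsc_on_sum lsc_on_compose_block_part F) auto
qed

section \<open>One pass of block updates\<close>

lemma splice_block_part [simp]: "splice b i u (block_part b i c) v = splice b i u c v"
  unfolding splice_def block_part_def by (auto simp: vec_eq_iff)

text \<open>Restates the subproblem and the majorization with the full gradient \<open>G\<close>;
  pairing \<open>G\<close> with a vector of the block sees only the partial gradient.\<close>

lemma block_pass_minimizer:
  fixes b :: "'n::finite \<Rightarrow> nat"
  assumes H: "\<And>x. H differentiable (at x)"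
    and pass: "block_pass b N H F \<D> R d L s \<gamma> \<sigma> x y x'" and i: "i \<in> {1..N}"
  defines "G \<equiv> gradient H (splice b i x' y x)"
  shows "d i \<in> \<D> i" and "0 < L i" and "L i < s i" and "1 < \<gamma> i" and "\<sigma> i = 1 / (\<gamma> i * s i)"
    and "\<And>c. c \<in> block_space b i \<Longrightarrow>
      F i (block_part b i x') + ereal (1 / (2 * \<sigma> i) * (d i (block_part b i x') (block_part b i y))\<^sup>2
          + G \<bullet> block_part b i (x' - y))
      \<le> F i c + ereal (1 / (2 * \<sigma> i) * (d i c (block_part b i y))\<^sup>2 + G \<bullet> (c - block_part b i y))"
    and "H (splice b i x' x' x) \<le> H (splice b i x' y x) + G \<bullet> block_part b i (x' - y)
      + L i / 2 * (d i (block_part b i x') (block_part b i y))\<^sup>2"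
proof -
  let ?V = "block_space b i"
  let ?h = "\<lambda>c. H (splice b i x' c x)"
  let ?g = "\<lambda>u. inv_into ?V (R i) (gradient_on ?V ?h u)"
  have p: "spd_on ?V (R i) \<and> d i \<in> \<D> i \<and> 0 < L i \<and>
         (\<forall>u\<in>?V. \<forall>v\<in>?V. ?h v \<le> ?h u + weighted_inner (R i) (?g u) (v - u) + L i / 2 * (d i v u)\<^sup>2) \<and>
         s i > L i \<and> \<gamma> i > 1 \<and> \<sigma> i = 1 / (\<gamma> i * s i) \<and>
         is_arg_min
           (\<lambda>c. F i c + ereal (1 / (2 * \<sigma> i) * (d i c (block_part b i y))\<^sup>2
              + weighted_inner (R i) (?g (block_part b i y)) (c - block_part b i y)))
           (\<lambda>c. c \<in> ?V) (block_part b i x')"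
    using pass[unfolded block_pass_def Let_def, THEN bspec, OF i] .
  note spd = p[THEN conjunct1]
    and quad = p[THEN conjunct2, THEN conjunct2, THEN conjunct2, THEN conjunct1, THEN bspec, THEN bspec]
    and mini = p[THEN conjunct2, THEN conjunct2, THEN conjunct2, THEN conjunct2, THEN conjunct2,
        THEN conjunct2, THEN conjunct2]
  show "d i \<in> \<D> i" and "0 < L i" and "L i < s i" and "1 < \<gamma> i" and "\<sigma> i = 1 / (\<gamma> i * s i)"
    using p by simp_all
  have w: "weighted_inner (R i) (?g (block_part b i y)) v = G \<bullet> v" if "v \<in> ?V" for v
  proof -
    have "gradient_on ?V ?h (block_part b i y) = block_part b i G"
      using gradient_on_block[OF H block_part_in_block_space[of b i y], where u = x' and v = x] by (simp add: G_def)
    then have "weighted_inner (R i) (?g (block_part b i y)) v = block_part b i G \<bullet> v"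
      using weighted_inner_inv_into[OF subspace_block_space spd block_part_in_block_space] by simp
    then show ?thesis using block_part_ident[OF that] by (simp add: inner_block_part)
  qed
  have sub: "c - block_part b i y \<in> ?V" if "c \<in> ?V" for c
    using subspace_diff[OF subspace_block_space that] by simp
  show "F i (block_part b i x') + ereal (1 / (2 * \<sigma> i) * (d i (block_part b i x') (block_part b i y))\<^sup>2
          + G \<bullet> block_part b i (x' - y))
      \<le> F i c + ereal (1 / (2 * \<sigma> i) * (d i c (block_part b i y))\<^sup>2 + G \<bullet> (c - block_part b i y))"
    if c: "c \<in> ?V" for c
  proof -
    have "F i (block_part b i x') + ereal (1 / (2 * \<sigma> i) * (d i (block_part b i x') (block_part b i y))\<^sup>2
          + weighted_inner (R i) (?g (block_part b i y)) (block_part b i x' - block_part b i y))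
      \<le> F i c + ereal (1 / (2 * \<sigma> i) * (d i c (block_part b i y))\<^sup>2
          + weighted_inner (R i) (?g (block_part b i y)) (c - block_part b i y))"
      using mini[unfolded is_arg_min_def, THEN conjunct2] c by (auto simp only: not_less not_ex de_Morgan_conj)
    then show ?thesis
      using w[OF sub[OF c]] w[OF sub[OF block_part_in_block_space[of b i x']]]
      by (simp add: block_part_diff)
  qed
  have "?h (block_part b i x') \<le> ?h (block_part b i y)
      + weighted_inner (R i) (?g (block_part b i y)) (block_part b i x' - block_part b i y)
      + L i / 2 * (d i (block_part b i x') (block_part b i y))\<^sup>2"
    by (rule quad) simp_all
  then show "H (splice b i x' x' x) \<le> H (splice b i x' y x) + G \<bullet> block_part b i (x' - y)
      + L i / 2 * (d i (block_part b i x') (block_part b i y))\<^sup>2"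
    using w[OF sub[OF block_part_in_block_space[of b i x']]] by (simp add: block_part_diff)
qed

lemma sum_splice_telescope:
  fixes b :: "'n::finite \<Rightarrow> nat"
  assumes "is_block_map b N"
  shows "(\<Sum>i=1..N. H (splice b i x' x' x) - H (splice b i x' x x)) = (H x' - H x :: real)"
proof -
  \<comment> \<open>The point after \<open>i\<close> block updates; replacing block \<open>i\<close>
    leads from \<open>w (i - 1)\<close> to \<open>w i\<close>.\<close>
  define w where "w i = (\<chi> j. if b j \<le> i then x' $ j else x $ j)" for i
  have "splice b i x' x' x = w i" "splice b i x' x x = w (i - 1)" if "i \<in> {1..N}" for i
    using that unfolding splice_def w_def by (auto simp: vec_eq_iff)
  then have "(\<Sum>i=1..N. H (splice b i x' x' x) - H (splice b i x' x x)) = (\<Sum>i=Suc 0..N. H (w i) - H (w (i - 1)))"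
    by (intro sum.cong) auto
  also have "\<dots> = H (w N) - H (w 0)" by (rule sum_telescope'') simp
  also have "\<dots> = H x' - H x"
  proof -
    have bj: "b j \<in> {1..N}" for j using assms unfolding is_block_map_def by auto
    have "w N $ j = x' $ j" "w 0 $ j = x $ j" for j using bj[of j] by (auto simp: w_def)
    then have "w N = x'" "w 0 = x" by (simp_all add: vec_eq_iff)
    then show ?thesis by simp
  qed
  finally show ?thesis .
qed

lemma objective_finite:
  assumes A2: "assumption_A2 b N F" and fin: "objective b N H F x < \<infinity>"
  shows "\<And>i. i \<in> {1..N} \<Longrightarrow> F i (block_part b i x) = ereal (real_of_ereal (F i (block_part b i x)))"
    and "objective b N H F x = ereal (H x + (\<Sum>i=1..N. real_of_ereal (F i (block_part b i x))))"
proof -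
  have nm: "F i (block_part b i x) \<noteq> -\<infinity>" if "i \<in> {1..N}" for i
    using A2 that unfolding assumption_A2_def proper_on_def by auto
  have "(\<Sum>i=1..N. F i (block_part b i x)) \<noteq> \<infinity>"
    using fin unfolding objective_def by auto
  then have ni: "F i (block_part b i x) \<noteq> \<infinity>" if "i \<in> {1..N}" for i
    using that by (auto simp: sum_Pinfty)
  show p: "F i (block_part b i x) = ereal (real_of_ereal (F i (block_part b i x)))" if "i \<in> {1..N}" for i
    using nm[OF that] ni[OF that] by (cases "F i (block_part b i x)") simp_all
  have "(\<Sum>i=1..N. F i (block_part b i x)) = (\<Sum>i=1..N. ereal (real_of_ereal (F i (block_part b i x))))"
    using p by (intro sum.cong refl)
  then show "objective b N H F x = ereal (H x + (\<Sum>i=1..N. real_of_ereal (F i (block_part b i x))))"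
    unfolding objective_def by simp
qed

text \<open>Without extrapolation the old block is a competitor whose metric and linear terms
  vanish. Adding the majorization of \<open>H\<close> cancels the gradient terms and leaves half of
  \<open>\<gamma> i * s i - L i\<close>, which is at least \<open>a / 2\<close> because
  \<open>L i < s i\<close>.\<close>

lemma block_pass_descent:
  fixes b :: "'n::finite \<Rightarrow> nat"
  assumes b: "is_block_map b N" and A1: "assumption_A1 b N H" and A2: "assumption_A2 b N F"
    and adm: "\<And>i. i \<in> {1..N} \<Longrightarrow> admissible_metrics (block_space b i) (nd i) (\<D> i)"
    and pass: "block_pass b N H F \<D> R d L s \<gamma> \<sigma> x x x'"
    and fin: "objective b N H F x = ereal v"
    and a: "\<And>i. i \<in> {1..N} \<Longrightarrow> a \<le> (\<gamma> i - 1) * s i"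
  shows "objective b N H F x' \<le> ereal (v - a / 2 * (\<Sum>i=1..N. (d i (block_part b i x') (block_part b i x))\<^sup>2))"
proof -
  have Hd: "H differentiable (at x)" for x using A1 unfolding assumption_A1_def by blast
  have "objective b N H F x < \<infinity>" using fin by simp
  note finite = objective_finite[OF A2 this]
  define p where "p i = real_of_ereal (F i (block_part b i x))" for i
  have p: "F i (block_part b i x) = ereal (p i)" if "i \<in> {1..N}" for i
    using finite(1)[OF that] by (simp only: p_def)
  have Jx: "objective b N H F x = ereal (H x + (\<Sum>i=1..N. p i))"
    using finite(2) by (simp only: p_def)
  define e where "e i = (d i (block_part b i x') (block_part b i x))\<^sup>2" for i
  have step: "F i (block_part b i x') \<le> ereal (p i - (H (splice b i x' x' x) - H (splice b i x' x x)) - a / 2 * e i)"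
    if i: "i \<in> {1..N}" for i
  proof -
    note props = block_pass_minimizer[OF Hd pass i]
    interpret Metric_space "block_space b i" "d i"
      using adm[OF i] props(1) unfolding admissible_metrics_def by blast
    have "d i (block_part b i x) (block_part b i x) = 0" by simp
    then have *: "F i (block_part b i x') + ereal (1 / (2 * \<sigma> i) * e i
          + gradient H (splice b i x' x x) \<bullet> block_part b i (x' - x)) \<le> ereal (p i)"
      using props(6)[OF block_part_in_block_space[of b i x]] p[OF i] by (simp add: e_def)
    have "1 / (2 * \<sigma> i) = \<gamma> i * s i / 2" using props(5) by simp
    moreover have "a / 2 \<le> \<gamma> i * s i / 2 - L i / 2" using a[OF i] props(3) by (simp add: algebra_simps)
    ultimately have "a / 2 * e i \<le> (1 / (2 * \<sigma> i) - L i / 2) * e i"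
      by (intro mult_right_mono) (simp_all add: e_def)
    then have "a / 2 * e i \<le> 1 / (2 * \<sigma> i) * e i - L i / 2 * e i" by (simp only: left_diff_distrib)
    moreover have "H (splice b i x' x' x) \<le> H (splice b i x' x x)
        + gradient H (splice b i x' x x) \<bullet> block_part b i (x' - x) + L i / 2 * e i"
      using props(7) by (simp add: e_def)
    ultimately show ?thesis using * by (cases "F i (block_part b i x')") auto
  qed
  have "objective b N H F x' \<le> ereal (H x') + (\<Sum>i=1..N. ereal (p i - (H (splice b i x' x' x) - H (splice b i x' x x)) - a / 2 * e i))"
    unfolding objective_def by (intro add_mono sum_mono step order_refl)
  also have "\<dots> = ereal (H x' + ((\<Sum>i=1..N. p i) - (H x' - H x) - a / 2 * (\<Sum>i=1..N. e i)))"
    by (simp only: sum_ereal sum_subtractf sum_splice_telescope[OF b, unfolded sum_subtractf] sum_distrib_left[symmetric] plus_ereal.simps)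
  also have "\<dots> = ereal (v - a / 2 * (\<Sum>i=1..N. e i))" using fin Jx by simp
  finally show ?thesis by (simp add: e_def)
qed

text \<open>The mean value theorem gives the constant \<Lambda> instead of half of it; any quadratic
  error serves the cusp bound.\<close>

lemma gradient_Lipschitz_lower:
  fixes H :: "'a::euclidean_space \<Rightarrow> real"
  assumes Hd: "\<And>x. H differentiable (at x)" and lip: "\<Lambda>-lipschitz_on S (gradient H)"
    and S: "convex S" "x \<in> S" "c \<in> S"
  shows "H x + gradient H x \<bullet> (c - x) - \<Lambda> * (norm (c - x))\<^sup>2 \<le> H c"
proof -
  let ?w = "\<lambda>t. x + t *\<^sub>R (c - x)"
  have d: "((\<lambda>t. H (?w t)) has_real_derivative (c - x) \<bullet> gradient H (?w t)) (at t)" for t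
  proof -
    have "((\<lambda>t. t *\<^sub>R (c - x)) has_derivative (\<lambda>t. t *\<^sub>R (c - x))) (at t)"
      by (rule bounded_linear_imp_has_derivative[OF bounded_linear_scaleR_left])
    then have "(?w has_derivative (\<lambda>t. t *\<^sub>R (c - x))) (at t)"
      using has_derivative_add[OF has_derivative_const] by force
    from has_derivative_compose[OF this has_derivative_gradient[OF Hd]]
    show ?thesis unfolding has_field_derivative_def by (simp add: mult_commute_abs)
  qed
  obtain t where t: "0 < t" "t < 1" "H (?w 1) - H (?w 0) = (1 - 0) * ((c - x) \<bullet> gradient H (?w t))"
    using MVT2[of 0 1 "\<lambda>t. H (?w t)" "\<lambda>t. (c - x) \<bullet> gradient H (?w t)"] d by auto
  have "?w t = (1 - t) *\<^sub>R x + t *\<^sub>R c" by (simp add: algebra_simps)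
  then have wS: "?w t \<in> S" using convexD_alt[OF S(1,2,3), of t] t by simp
  have \<Lambda>: "\<Lambda> \<ge> 0" using lip by (rule lipschitz_on_nonneg)
  have "norm (gradient H (?w t) - gradient H x) \<le> \<Lambda> * norm (t *\<^sub>R (c - x))"
    using lipschitz_onD[OF lip wS S(2)] by (simp add: dist_norm)
  also have "\<dots> \<le> \<Lambda> * norm (c - x)"
    using t \<Lambda> by (intro mult_left_mono) (auto simp: mult_left_le_one_le)
  finally have "norm (c - x) * norm (gradient H (?w t) - gradient H x) \<le> norm (c - x) * (\<Lambda> * norm (c - x))"
    by (intro mult_left_mono) auto
  then have "\<bar>(c - x) \<bullet> (gradient H (?w t) - gradient H x)\<bar> \<le> \<Lambda> * (norm (c - x))\<^sup>2"
    using Cauchy_Schwarz_ineq2[of "c - x" "gradient H (?w t) - gradient H x"]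
    by (simp add: power2_eq_square mult_ac)
  moreover have "H c - H x = (c - x) \<bullet> gradient H (?w t)" using t(3) by simp
  ultimately show ?thesis
    unfolding inner_commute[of "gradient H x" "c - x"] inner_diff_right[of "c - x"] by linarith
qed

text \<open>The difference vanishes on the blocks before \<open>i\<close>, is part of
  \<open>x' - y\<close> on block \<open>i\<close> and part of \<open>x' - x\<close> after
  it.\<close>

lemma norm_diff_splice_le: "norm (x' - splice b i x' y x) \<le> norm (x' - x) + norm (x' - y)"
proof -
  let ?m = "\<chi> j. if b j > i then (x' - x) $ j else 0"
  have "x' - splice b i x' y x = ?m + block_part b i (x' - y)"
    unfolding splice_def block_part_def by (auto simp: vec_eq_iff)
  moreover have "norm ?m \<le> norm (x' - x)" by (rule norm_le_componentwise_cart) simp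
  moreover have "norm (block_part b i (x' - y)) \<le> norm (x' - y)" by (rule norm_block_part_le)
  ultimately show ?thesis using norm_triangle_ineq[of ?m "block_part b i (x' - y)"] by simp
qed

text \<open>The cusp bound. Minimality of each block against the same block of \<open>c\<close>
  bounds \<open>F i\<close> below, up to the growth of a squared metric and the change of the
  gradient between \<open>splice b i x' y x\<close> and \<open>x'\<close>. Both errors are linear in
  \<open>norm (c - x')\<close> with a factor of step size, up to a quadratic term.\<close>

lemma block_pass_objective_lower:
  fixes b :: "'n::finite \<Rightarrow> nat"
  assumes b: "is_block_map b N" and Hd: "\<And>x. H differentiable (at x)" and A2: "assumption_A2 b N F"
    and adm: "\<And>i. i \<in> {1..N} \<Longrightarrow> admissible_metrics (block_space b i) (nd i) (\<D> i)"
    and pass: "block_pass b N H F \<D> R d L s \<gamma> \<sigma> x y x'"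
    and fin: "objective b N H F x' = ereal v"
    and r: "norm x \<le> r" "norm y \<le> r" "norm x' \<le> r"
    and lip: "\<Lambda>-lipschitz_on (cball 0 (5 * r + 1)) (gradient H)"
    and M: "M \<ge> 0" "\<And>i u w. i \<in> {1..N} \<Longrightarrow> u \<in> block_space b i \<Longrightarrow> w \<in> block_space b i \<Longrightarrow>
        norm u \<le> r + 1 \<Longrightarrow> norm w \<le> r + 1 \<Longrightarrow> d i u w \<le> M * norm (u - w)"
    and \<sigma>0: "0 < \<sigma>0" "\<And>i. i \<in> {1..N} \<Longrightarrow> \<sigma>0 \<le> \<sigma> i"
    and c: "norm (c - x') \<le> 1"
  shows "ereal (v - real N * (\<Lambda> + M\<^sup>2 / \<sigma>0) * (norm (x' - x) + norm (x' - y)) * norm (c - x')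
      - (\<Lambda> + real N * (M\<^sup>2 / (2 * \<sigma>0))) * (norm (c - x'))\<^sup>2) \<le> objective b N H F c"
proof -
  have r0: "r \<ge> 0" using r(1) norm_ge_zero order_trans by blast
  have \<Lambda>: "\<Lambda> \<ge> 0" using lip by (rule lipschitz_on_nonneg)
  have "norm c \<le> norm x' + norm (c - x')" by (metis add_diff_cancel_left' diff_add_cancel norm_triangle_sub)
  then have nc: "norm c \<le> r + 1" using c r by simp
  define e where "e = norm (c - x')"
  define S where "S = norm (x' - x) + norm (x' - y)"
  have e0: "e \<ge> 0" and S0: "S \<ge> 0" by (simp_all add: e_def S_def)
  have "objective b N H F x' < \<infinity>" using fin by simp
  note finite = objective_finite[OF A2 this]
  define q where "q i = real_of_ereal (F i (block_part b i x'))" for i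
  have q: "F i (block_part b i x') = ereal (q i)" if "i \<in> {1..N}" for i
    using finite(1)[OF that] by (simp only: q_def)
  have Jx: "objective b N H F x' = ereal (H x' + (\<Sum>i=1..N. q i))"
    using finite(2) by (simp only: q_def)
  \<comment> \<open>Error of a single block: gradient mismatch, plus growth of the squared metric
    with \<open>1 / (2 * \<sigma> i)\<close> bounded by \<open>1 / (2 * \<sigma>0)\<close>.\<close>
  define T where "T = \<Lambda> * S * e + (2 * M\<^sup>2 * S * e + M\<^sup>2 * e\<^sup>2) / (2 * \<sigma>0)"
  have low: "ereal (q i - gradient H x' \<bullet> block_part b i (c - x') - T) \<le> F i (block_part b i c)"
    if i: "i \<in> {1..N}" for i
  proof -
    note props = block_pass_minimizer[OF Hd pass i]
    interpret Metric_space "block_space b i" "d i"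
      using adm[OF i] props(1) unfolding admissible_metrics_def by blast
    let ?X = "block_part b i x'" and ?Y = "block_part b i y" and ?C = "block_part b i c"
    let ?G = "gradient H (splice b i x' y x)"
    have XY: "norm (?X - ?Y) \<le> S"
      using norm_block_part_le[of b i "x' - y"] norm_ge_zero[of "x' - x"] unfolding S_def block_part_diff by linarith
    have CX: "norm (?C - ?X) \<le> e"
      using norm_block_part_le[of b i "c - x'"] unfolding e_def block_part_diff .
    have nX: "norm ?X \<le> r + 1" "norm ?Y \<le> r + 1" "norm ?C \<le> r + 1"
      using norm_block_part_le[of b i x'] norm_block_part_le[of b i y] norm_block_part_le[of b i c] r nc by linarith+
    have dXY: "d i ?X ?Y \<le> M * S"
      using M(2)[OF i block_part_in_block_space block_part_in_block_space nX(1,2)] mult_left_mono[OF XY M(1)] by linarith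
    have dCX: "d i ?C ?X \<le> M * e"
      using M(2)[OF i block_part_in_block_space block_part_in_block_space nX(3,1)] mult_left_mono[OF CX M(1)] by linarith
    \<comment> \<open>Going through \<open>?X\<close> makes the squared distance from
      \<open>?X\<close> to \<open>?Y\<close> cancel, so the remainder vanishes with
      \<open>e\<close>.\<close>
    have "d i ?C ?Y \<le> M * e + d i ?X ?Y"
      using triangle[of ?C ?X ?Y] dCX by simp
    then have "(d i ?C ?Y)\<^sup>2 \<le> (M * e + d i ?X ?Y)\<^sup>2" by (intro power_mono) simp_all
    also have "\<dots> = (d i ?X ?Y)\<^sup>2 + (2 * (M * e) * d i ?X ?Y + M\<^sup>2 * e\<^sup>2)"
      by (simp add: power2_sum power_mult_distrib)
    also have "\<dots> \<le> (d i ?X ?Y)\<^sup>2 + (2 * (M * e) * (M * S) + M\<^sup>2 * e\<^sup>2)"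
      using dXY M(1) e0 by (intro add_left_mono add_right_mono mult_left_mono) simp_all
    also have "2 * (M * e) * (M * S) = 2 * M\<^sup>2 * S * e" by (simp add: power2_eq_square)
    finally have sq: "(d i ?C ?Y)\<^sup>2 - (d i ?X ?Y)\<^sup>2 \<le> 2 * M\<^sup>2 * S * e + M\<^sup>2 * e\<^sup>2" by simp
    have \<sigma>: "\<sigma> i > 0" "1 / (2 * \<sigma> i) \<le> 1 / (2 * \<sigma>0)"
      using \<sigma>0(1) \<sigma>0(2)[OF i] by (simp_all add: frac_le)
    have "1 / (2 * \<sigma> i) * ((d i ?C ?Y)\<^sup>2 - (d i ?X ?Y)\<^sup>2) \<le> 1 / (2 * \<sigma> i) * (2 * M\<^sup>2 * S * e + M\<^sup>2 * e\<^sup>2)"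
      using sq \<sigma>(1) by (intro mult_left_mono) simp_all
    also have "\<dots> \<le> 1 / (2 * \<sigma>0) * (2 * M\<^sup>2 * S * e + M\<^sup>2 * e\<^sup>2)"
      using \<sigma>(2) S0 e0 by (intro mult_right_mono) simp_all
    finally have quad: "1 / (2 * \<sigma> i) * (d i ?C ?Y)\<^sup>2 - 1 / (2 * \<sigma> i) * (d i ?X ?Y)\<^sup>2
        \<le> (2 * M\<^sup>2 * S * e + M\<^sup>2 * e\<^sup>2) / (2 * \<sigma>0)" by (simp only: right_diff_distrib) simp
    have sp: "norm (x' - splice b i x' y x) \<le> S" unfolding S_def by (rule norm_diff_splice_le)
    \<comment> \<open>Places the spliced point in the ball of radius \<open>5 * r\<close>, where the
      gradient is Lipschitz.\<close>
    have "S \<le> 4 * r"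
      using norm_triangle_ineq4[of x' x] norm_triangle_ineq4[of x' y] r unfolding S_def by linarith
    then have "norm (splice b i x' y x) \<le> 5 * r"
      using norm_triangle_ineq3[of x' "splice b i x' y x"] sp r(3) by linarith
    then have "dist (gradient H (splice b i x' y x)) (gradient H x') \<le> \<Lambda> * dist (splice b i x' y x) x'"
      using r(3) r0 by (intro lipschitz_onD[OF lip]) simp_all
    then have "norm (?G - gradient H x') \<le> \<Lambda> * norm (x' - splice b i x' y x)"
      by (simp only: dist_norm norm_minus_commute[of x'])
    also have "\<dots> \<le> \<Lambda> * S" using sp \<Lambda> by (rule mult_left_mono)
    finally have Gd: "norm (?G - gradient H x') \<le> \<Lambda> * S" .
    have "(?G - gradient H x') \<bullet> block_part b i (c - x') \<le> norm (?G - gradient H x') * norm (block_part b i (c - x'))"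
      by (rule norm_cauchy_schwarz)
    also have "\<dots> \<le> (\<Lambda> * S) * e"
      using Gd CX S0 \<Lambda> by (intro mult_mono) (simp_all add: block_part_diff)
    finally have lin: "?G \<bullet> block_part b i (c - x') \<le> gradient H x' \<bullet> block_part b i (c - x') + \<Lambda> * S * e"
      by (simp add: inner_diff_left)
    have "?G \<bullet> (?C - ?Y) - ?G \<bullet> block_part b i (x' - y) = ?G \<bullet> block_part b i (c - x')"
      by (simp add: block_part_diff inner_diff_right)
    with quad lin have "q i - gradient H x' \<bullet> block_part b i (c - x') - T \<le>
        q i + (1 / (2 * \<sigma> i) * (d i ?X ?Y)\<^sup>2 + ?G \<bullet> block_part b i (x' - y))
          - (1 / (2 * \<sigma> i) * (d i ?C ?Y)\<^sup>2 + ?G \<bullet> (?C - ?Y))"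
      unfolding T_def by linarith
    then show ?thesis
      using props(6)[OF block_part_in_block_space[of b i c]] q[OF i] by (cases "F i ?C") simp_all
  qed
  have "x' \<in> cball 0 (5 * r + 1)" "c \<in> cball 0 (5 * r + 1)" using r(3) nc r0 by simp_all
  then have Hc: "H x' + gradient H x' \<bullet> (c - x') - \<Lambda> * e\<^sup>2 \<le> H c"
    unfolding e_def by (intro gradient_Lipschitz_lower[OF Hd lip]) simp_all
  \<comment> \<open>The linear terms of the blocks add up to the one in the lower bound for
    \<open>H c\<close>, with opposite sign.\<close>
  have sumG: "(\<Sum>i=1..N. gradient H x' \<bullet> block_part b i (c - x')) = gradient H x' \<bullet> (c - x')"
    by (simp only: inner_sum_right[symmetric] sum_block_part[OF b])
  have "v = H x' + (\<Sum>i=1..N. q i)" using Jx fin by simp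
  then have "v - real N * (\<Lambda> + M\<^sup>2 / \<sigma>0) * S * e - (\<Lambda> + real N * (M\<^sup>2 / (2 * \<sigma>0))) * e\<^sup>2
      = (H x' + gradient H x' \<bullet> (c - x') - \<Lambda> * e\<^sup>2) + ((\<Sum>i=1..N. q i) - gradient H x' \<bullet> (c - x') - real N * T)"
    using \<sigma>0(1) unfolding T_def by (simp add: field_simps)
  also have "(\<Sum>i=1..N. q i) - gradient H x' \<bullet> (c - x') - real N * T
      = (\<Sum>i=1..N. q i - gradient H x' \<bullet> block_part b i (c - x') - T)"
    by (simp add: sum_subtractf sumG[simplified])
  finally have "ereal (v - real N * (\<Lambda> + M\<^sup>2 / \<sigma>0) * S * e - (\<Lambda> + real N * (M\<^sup>2 / (2 * \<sigma>0))) * e\<^sup>2)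
      = ereal (H x' + gradient H x' \<bullet> (c - x') - \<Lambda> * e\<^sup>2) + (\<Sum>i=1..N. ereal (q i - gradient H x' \<bullet> block_part b i (c - x') - T))"
    by simp
  also have "\<dots> \<le> objective b N H F c"
    unfolding objective_def using Hc by (intro add_mono sum_mono low) simp_all
  finally show ?thesis by (simp only: S_def e_def)
qed

section \<open>Extrapolation weights and the generated sequence\<close>

lemma t_seq_ge_1: "1 \<le> t_seq k"
proof (induction k rule: t_seq.induct)
  case (3 k)
  have "1 \<le> sqrt (1 + 4 * (t_seq (Suc k))\<^sup>2)" by (rule real_le_rsqrt) simp
  then show ?case by simp
qed simp_all

lemma t_seq_le_Suc: "t_seq k \<le> t_seq (Suc k)"
proof (cases k)
  case (Suc j)
  have "2 * t_seq (Suc j) \<le> sqrt (1 + 4 * (t_seq (Suc j))\<^sup>2)"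
    by (rule real_le_rsqrt) (simp add: power_mult_distrib)
  then show ?thesis using Suc by simp
qed simp

text \<open>Keeps the extrapolated point within one previous step length of the current
  iterate.\<close>

lemma beta_seq_bounds: "0 \<le> beta_seq k" "beta_seq k \<le> 1"
proof -
  have "t_seq (k - 1) \<le> t_seq k" by (cases k) (simp_all add: t_seq_le_Suc)
  then show "0 \<le> beta_seq k" "beta_seq k \<le> 1"
    using t_seq_ge_1[of "k - 1"] t_seq_ge_1[of k] unfolding beta_seq_def by (simp_all add: divide_le_eq)
qed

lemma sum_norm_block_part_sq:
  fixes x :: "real^'n::finite"
  assumes "is_block_map b N"
  shows "(\<Sum>i=1..N. (norm (block_part b i x))\<^sup>2) = (norm x)\<^sup>2"
proof -
  have "(norm (block_part b i x))\<^sup>2 = x \<bullet> block_part b i x" for i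
    by (simp add: power2_norm_eq_inner inner_block_part)
  then show ?thesis
    by (simp only: inner_sum_right[symmetric] sum_block_part[OF assms] power2_norm_eq_inner)
qed

lemma iGGBPL_start:
  assumes "iGGBPL b N H F \<D> \<rho> R d L s \<gamma> \<sigma> z"
  shows "z 1 = z 0" "objective b N H F (z 0) < \<infinity>" "0 < \<rho>"
  using assms unfolding iGGBPL_def edom_def by simp_all

text \<open>The two cases correspond to two sources of decrease: either the acceptance test itself
  supplies it, or the pass ran without extrapolation and \<open>block_pass_descent\<close>
  does.\<close>

lemma iGGBPL_pass:
  assumes "iGGBPL b N H F \<D> \<rho> R d L s \<gamma> \<sigma> z" "k \<ge> 1"
  shows "block_pass b N H F \<D> (R k) (d k) (L k) (s k) (\<gamma> k) (\<sigma> k) (z k)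
        (z k + beta_seq k *\<^sub>R (z k - z (k - 1))) (z (Suc k)) \<and>
      \<not> redo_needed b N (objective b N H F) \<rho> (d k) (z k) (z (Suc k))
    \<or> block_pass b N H F \<D> (R k) (d k) (L k) (s k) (\<gamma> k) (\<sigma> k) (z k) (z k) (z (Suc k))"
  using assms unfolding iGGBPL_def Let_def Suc_eq_plus1 by blast

theorem theorem4:
  fixes b :: "'n::finite \<Rightarrow> nat" and N :: nat
    and H :: "real^'n \<Rightarrow> real"
    and F :: "nat \<Rightarrow> real^'n \<Rightarrow> ereal"
    and nd :: "nat \<Rightarrow> real^'n \<Rightarrow> real"
    and \<D> :: "nat \<Rightarrow> (real^'n \<Rightarrow> real^'n \<Rightarrow> real) set"
    and \<rho> :: real
    and R :: "nat \<Rightarrow> nat \<Rightarrow> real^'n \<Rightarrow> real^'n"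
    and d :: "nat \<Rightarrow> nat \<Rightarrow> real^'n \<Rightarrow> real^'n \<Rightarrow> real"
    and L s \<gamma> \<sigma> :: "nat \<Rightarrow> nat \<Rightarrow> real"
    and z :: "nat \<Rightarrow> real^'n"
  assumes "is_block_map b N"
    and "assumption_A1 b N H"
    and "assumption_A2 b N F"
    and "assumption_A3 (objective b N H F)"
    and "\<And>i. i \<in> {1..N} \<Longrightarrow> admissible_metrics (block_space b i) (nd i) (\<D> i)"
    and "iGGBPL b N H F \<D> \<rho> R d L s \<gamma> \<sigma> z"
    and "0 < (INF (i, k)\<in>{1..N} \<times> {1..}. (\<gamma> k i - 1) * s k i)"
    and "0 < (INF (i, k)\<in>{1..N} \<times> {1..}. \<sigma> k i)"
  shows "convergent z \<and>
    (\<lambda>k. SUP p. ereal (prod_norm b N nd (z (k + p) - z k))) \<longlonglongrightarrow> 0 \<and>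
    norm_on UNIV (prod_norm b N nd) \<and>
    Metric_space.mcomplete UNIV (\<lambda>u v. prod_norm b N nd (u - v))"
proof -
  let ?J = "objective b N H F"
  note b = assms(1) and A1 = assms(2) and A2 = assms(3) and adm = assms(5)
  have Hd: "H differentiable (at x)" for x using A1 unfolding assumption_A1_def by blast
  have J: "KL_function ?J" "ecoercive ?J" "ebdd_below_on UNIV ?J"
    using assms(4) unfolding assumption_A3_def by simp_all
  \<comment> \<open>Any coordinate shows that there is a block, so the infima and the minimum below
    range over nonempty sets.\<close>
  have "b undefined \<in> {1..N}" using b unfolding is_block_map_def by auto
  then have N1: "1 \<in> {1..N}" by simp
  have ndn: "norm_on (block_space b i) (nd i)" if "i \<in> {1..N}" for i
    using adm[OF that] unfolding admissible_metrics_def by (elim conjE)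
  have pn: "norm_on UNIV (prod_norm b N nd)" by (rule norm_on_prod_norm[OF b ndn])
  obtain c C where "c > 0" "C > 0" "\<And>x. c * norm x \<le> prod_norm b N nd x" "\<And>x. prod_norm b N nd x \<le> C * norm x"
    using norm_on_equivalent[OF pn] by blast
  note cC = this
  have rho: "\<rho> > 0" and z01: "z 1 = z 0" and z0: "?J (z 0) < \<infinity>"
    using iGGBPL_start[OF assms(6)] by simp_all
  note pass = iGGBPL_pass[OF assms(6)]
  have par: "d k i \<in> \<D> i \<and> 0 < L k i \<and> L k i < s k i \<and> 1 < \<gamma> k i \<and> \<sigma> k i = 1 / (\<gamma> k i * s k i)"
    if k: "k \<ge> 1" and i: "i \<in> {1..N}" for k i
  proof -
    obtain y where p: "block_pass b N H F \<D> (R k) (d k) (L k) (s k) (\<gamma> k) (\<sigma> k) (z k) y (z (Suc k))"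
      using pass[OF k] by blast
    show ?thesis using block_pass_minimizer(1-5)[OF Hd p i] by simp
  qed
  define a where "a = (INF (i, k)\<in>{1..N} \<times> {1..}. (\<gamma> k i - 1) * s k i)"
  define \<sigma>0 where "\<sigma>0 = (INF (i, k)\<in>{1..N} \<times> {1..}. \<sigma> k i)"
  have a0: "a > 0" and \<sigma>00: "\<sigma>0 > 0" using assms(7,8) by (simp_all add: a_def \<sigma>0_def)
  have a: "a \<le> (\<gamma> k i - 1) * s k i" if "k \<ge> 1" "i \<in> {1..N}" for k i
  proof -
    \<comment> \<open>A real infimum is a lower bound only for a set bounded below; the parameter
      constraints provide the bound 0.\<close>
    have "bdd_below ((\<lambda>(i, k). (\<gamma> k i - 1) * s k i) ` ({1..N} \<times> {1..}))"
      using par by (intro bdd_belowI2[of _ 0]) (fastforce intro: mult_nonneg_nonneg)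
    from cINF_lower[OF this, of "(i, k)"] show ?thesis using that by (simp add: a_def)
  qed
  have \<sigma>: "\<sigma>0 \<le> \<sigma> k i" if "k \<ge> 1" "i \<in> {1..N}" for k i
  proof -
    have "bdd_below ((\<lambda>(i, k). \<sigma> k i) ` ({1..N} \<times> {1..}))"
      using par by (intro bdd_belowI2[of _ 0]) fastforce
    from cINF_lower[OF this, of "(i, k)"] show ?thesis using that by (simp add: \<sigma>0_def)
  qed
  \<comment> \<open>The smaller of the decrease rates of the acceptance test and of the pass without
    extrapolation.\<close>
  define \<kappa> where "\<kappa> = min \<rho> (a / 2)"
  have \<kappa>: "\<kappa> > 0" using rho a0 by (simp add: \<kappa>_def)
  define Q where "Q k = (\<Sum>i=1..N. (d k i (block_part b i (z (Suc k))) (block_part b i (z k)))\<^sup>2)" for k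
  have Q0: "Q k \<ge> 0" for k unfolding Q_def by (intro sum_nonneg) simp
  have desc: "?J (z (Suc k)) \<le> ereal (w - \<kappa> * Q k)" if k: "k \<ge> 1" and w: "?J (z k) = ereal w" for k w
    using pass[OF k]
  proof
    assume "block_pass b N H F \<D> (R k) (d k) (L k) (s k) (\<gamma> k) (\<sigma> k) (z k)
        (z k + beta_seq k *\<^sub>R (z k - z (k - 1))) (z (Suc k)) \<and> \<not> redo_needed b N ?J \<rho> (d k) (z k) (z (Suc k))"
    then have "?J (z (Suc k)) \<le> ereal (w - \<rho> * Q k)"
      using w unfolding redo_needed_def Q_def by (simp add: not_less)
    also have "\<dots> \<le> ereal (w - \<kappa> * Q k)" using Q0[of k] by (simp add: \<kappa>_def mult_right_mono)
    finally show ?thesis .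
  next
    assume "block_pass b N H F \<D> (R k) (d k) (L k) (s k) (\<gamma> k) (\<sigma> k) (z k) (z k) (z (Suc k))"
    from block_pass_descent[OF b A1 A2 adm this w a[OF k]]
    have "?J (z (Suc k)) \<le> ereal (w - a / 2 * Q k)" unfolding Q_def by simp
    also have "\<dots> \<le> ereal (w - \<kappa> * Q k)" using mult_right_mono[of \<kappa> "a / 2" "Q k"] Q0[of k] by (simp add: \<kappa>_def)
    finally show ?thesis .
  qed
  obtain m :: real where m: "\<And>x. ereal m \<le> ?J x" using J(3) unfolding ebdd_below_on_def by auto
  define v where "v k = real_of_ereal (?J (z k))" for k
  have fin_real: "?J (z k) = ereal (v k)" if "?J (z k) < \<infinity>" for k
    using that m[of "z k"] unfolding v_def by (cases "?J (z k)") simp_all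
  have vk: "?J (z k) = ereal (v k)" for k
  proof (induction k)
    case (Suc k)
    show ?case
    proof (cases "k = 0")
      case True
      then show ?thesis using fin_real[of 1] z01 z0 by simp
    next
      case False
      then have "?J (z (Suc k)) \<le> ereal (v k - \<kappa> * Q k)" by (intro desc Suc.IH) simp
      then show ?thesis by (intro fin_real) (cases "?J (z (Suc k))"; simp)
    qed
  qed (rule fin_real[OF z0])
  have "\<forall>i\<in>{1..N}. \<exists>c>0. \<forall>d\<in>\<D> i. \<forall>x\<in>block_space b i. \<forall>y\<in>block_space b i. c * nd i (x - y) \<le> d x y"
    using adm unfolding admissible_metrics_def by simp
  from bchoice[OF this] obtain Cd where Cd: "\<forall>i\<in>{1..N}. Cd i > 0 \<and> (\<forall>d\<in>\<D> i. \<forall>x\<in>block_space b i.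
      \<forall>y\<in>block_space b i. Cd i * nd i (x - y) \<le> d x y)" by blast
  define C0 where "C0 = Min (Cd ` {1..N})"
  have C0: "C0 > 0" "\<And>i. i \<in> {1..N} \<Longrightarrow> C0 \<le> Cd i" using Cd N1 unfolding C0_def by auto
  \<comment> \<open>\<open>C0\<close> comes from (B1), uniformly over the blocks, and
    \<open>c\<close> from the equivalence of the product norm with the Euclidean one.\<close>
  have QD: "(C0 * c)\<^sup>2 * (norm (z (Suc k) - z k))\<^sup>2 \<le> Q k" if k: "k \<ge> 1" for k
  proof -
    have "(C0 * c)\<^sup>2 * (norm (block_part b i (z (Suc k) - z k)))\<^sup>2
        \<le> (d k i (block_part b i (z (Suc k))) (block_part b i (z k)))\<^sup>2" if i: "i \<in> {1..N}" for i
    proof -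
      let ?u = "block_part b i (z (Suc k) - z k)"
      have n: "c * norm ?u \<le> nd i ?u"
        using cC(3)[of ?u] prod_norm_block[OF ndn i block_part_in_block_space] by simp
      have "0 \<le> c * norm ?u" using cC(1) by simp
      then have "C0 * (c * norm ?u) \<le> Cd i * nd i ?u"
        using n C0(1) C0(2)[OF i] by (intro mult_mono) simp_all
      also have "\<dots> \<le> d k i (block_part b i (z (Suc k))) (block_part b i (z k))"
        using Cd i par[OF k i] block_part_in_block_space unfolding block_part_diff by blast
      finally have "(C0 * (c * norm ?u))\<^sup>2 \<le> (d k i (block_part b i (z (Suc k))) (block_part b i (z k)))\<^sup>2"
        using C0(1) cC(1) by (intro power_mono) simp_all
      then show ?thesis by (simp add: power_mult_distrib mult.assoc)
    qed
    then have "(\<Sum>i=1..N. (C0 * c)\<^sup>2 * (norm (block_part b i (z (Suc k) - z k)))\<^sup>2) \<le> Q k"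
      unfolding Q_def by (rule sum_mono)
    then show ?thesis by (simp only: sum_distrib_left[symmetric] sum_norm_block_part_sq[OF b])
  qed
  define \<alpha> where "\<alpha> = \<kappa> * (C0 * c)\<^sup>2"
  have \<alpha>: "\<alpha> > 0" using \<kappa> C0 cC(1) by (simp add: \<alpha>_def)
  have vdesc: "v (Suc k) + \<alpha> * (norm (z (Suc k) - z k))\<^sup>2 \<le> v k" for k
  proof (cases "k = 0")
    \<comment> \<open>No iteration has index 0, but \<open>z 1 = z 0\<close> makes this step
      trivial.\<close>
    case True
    then show ?thesis using z01 by (simp add: v_def)
  next
    case False
    then have k: "k \<ge> 1" by simp
    have "v (Suc k) \<le> v k - \<kappa> * Q k" using desc[OF k vk] vk[of "Suc k"] by simp
    moreover have "\<alpha> * (norm (z (Suc k) - z k))\<^sup>2 \<le> \<kappa> * Q k"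
      using mult_left_mono[OF QD[OF k], of \<kappa>] \<kappa> by (simp add: \<alpha>_def mult.assoc)
    ultimately show ?thesis by simp
  qed
  have v0: "v k \<le> v 0" for k
  proof (induction k)
    case (Suc k)
    have "0 \<le> \<alpha> * (norm (z (Suc k) - z k))\<^sup>2" using \<alpha> by simp
    then show ?case using vdesc[of k] Suc.IH by linarith
  qed simp
  have "\<forall>\<^sub>F x in at_infinity. ereal (v 0) < ?J x"
    using J(2) unfolding ecoercive_def by (rule order_tendstoD) simp
  then obtain r0 where r0: "\<And>x. norm x \<ge> r0 \<Longrightarrow> ereal (v 0) < ?J x" unfolding eventually_at_infinity by blast
  have zr: "norm (z k) \<le> r0" for k
    using r0[of "z k"] v0[of k] vk[of k] by (cases "norm (z k) \<ge> r0") simp_all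
  \<comment> \<open>An extrapolated point is at most \<open>2 * r0\<close> away from an iterate,
    whose norm is at most \<open>r0\<close>.\<close>
  define r where "r = 3 * r0"
  have r00: "r0 \<ge> 0" using zr[of 0] norm_ge_zero order_trans by blast
  have "bounded (cball (0::real^'n) (5 * r + 1))" by simp
  then obtain \<Lambda> where lip: "\<Lambda>-lipschitz_on (cball 0 (5 * r + 1)) (gradient H)"
    using A1 unfolding assumption_A1_def by blast
  have "\<forall>i\<in>{1..N}. \<exists>M\<ge>0. \<forall>d\<in>\<D> i. \<forall>u\<in>block_space b i. \<forall>w\<in>block_space b i.
      norm u \<le> r + 1 \<longrightarrow> norm w \<le> r + 1 \<longrightarrow> d u w \<le> M * norm (u - w)"
  proof
    fix i assume i: "i \<in> {1..N}"
    show "\<exists>M\<ge>0. \<forall>d\<in>\<D> i. \<forall>u\<in>block_space b i. \<forall>w\<in>block_space b i.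
      norm u \<le> r + 1 \<longrightarrow> norm w \<le> r + 1 \<longrightarrow> d u w \<le> M * norm (u - w)"
      by (rule admissible_metrics_le[OF subspace_block_space adm[OF i], of "r + 1"]) blast
  qed
  from bchoice[OF this] obtain Mi where Mi: "\<forall>i\<in>{1..N}. Mi i \<ge> 0 \<and> (\<forall>d\<in>\<D> i. \<forall>u\<in>block_space b i. \<forall>w\<in>block_space b i.
      norm u \<le> r + 1 \<longrightarrow> norm w \<le> r + 1 \<longrightarrow> d u w \<le> Mi i * norm (u - w))" by blast
  \<comment> \<open>A sum of nonnegative constants dominates each of them, so one \<open>M\<close>
    serves all blocks.\<close>
  define M where "M = (\<Sum>i=1..N. Mi i)"
  have M0: "M \<ge> 0" unfolding M_def using Mi by (intro sum_nonneg) blast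
  have M: "d k i u w \<le> M * norm (u - w)"
    if k: "k \<ge> 1" and i: "i \<in> {1..N}" and u: "u \<in> block_space b i" "w \<in> block_space b i"
      "norm u \<le> r + 1" "norm w \<le> r + 1" for k i u w
  proof -
    have "d k i u w \<le> Mi i * norm (u - w)" using Mi i u par[OF k i] by blast
    also have "\<dots> \<le> M * norm (u - w)"
      unfolding M_def using Mi i by (intro mult_right_mono member_le_sum) auto
    finally show ?thesis .
  qed
  define B where "B = real N * (\<Lambda> + M\<^sup>2 / \<sigma>0)"
  define A where "A = \<Lambda> + real N * (M\<^sup>2 / (2 * \<sigma>0))"
  have \<Lambda>: "\<Lambda> \<ge> 0" using lip by (rule lipschitz_on_nonneg)
  have B: "B \<ge> 0" "A \<ge> 0" unfolding A_def B_def using \<Lambda> \<sigma>00 by simp_all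
  \<comment> \<open>The factor 2 arises because the last step counts twice: once by itself and once
    within the distance from \<open>z (k + 2)\<close> to \<open>y\<close>, which is at most
    \<open>D1 + D0\<close>.\<close>
  have low: "ereal (v (k + 2) - (2 * B) * (norm (z (k + 2) - z (k + 1)) + norm (z (k + 1) - z k)) * norm (x - z (k + 2))
        - A * (norm (x - z (k + 2)))\<^sup>2) \<le> ?J x" if x: "norm (x - z (k + 2)) \<le> 1" for k x
  proof -
    have k1: "k + 1 \<ge> 1" by simp
    define D1 where "D1 = norm (z (k + 2) - z (k + 1))"
    define D0 where "D0 = norm (z (k + 1) - z k)"
    have "\<exists>y. block_pass b N H F \<D> (R (k+1)) (d (k+1)) (L (k+1)) (s (k+1)) (\<gamma> (k+1)) (\<sigma> (k+1)) (z (k+1)) y (z (k+2))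
        \<and> norm (y - z (k + 1)) \<le> D0"
      using pass[OF k1]
    proof (elim disjE conjE, goal_cases)
      case 1
      let ?y = "z (k + 1) + beta_seq (k + 1) *\<^sub>R (z (k + 1) - z (k + 1 - 1))"
      have "norm (?y - z (k + 1)) \<le> D0"
        using beta_seq_bounds[of "k + 1"] by (simp add: D0_def mult_left_le_one_le)
      then show ?case using 1(1) by (intro exI[of _ ?y]) simp
    next
      case 2
      then show ?case by (intro exI[of _ "z (k + 1)"]) (simp add: D0_def)
    qed
    then obtain y where p: "block_pass b N H F \<D> (R (k+1)) (d (k+1)) (L (k+1)) (s (k+1)) (\<gamma> (k+1)) (\<sigma> (k+1)) (z (k+1)) y (z (k+2))"
      and y: "norm (y - z (k + 1)) \<le> D0" by blast
    have "D0 \<le> 2 * r0" using norm_triangle_ineq4[of "z (k + 1)" "z k"] zr[of "k + 1"] zr[of k] unfolding D0_def by linarith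
    then have ny: "norm y \<le> r"
      using y zr[of "k + 1"] norm_triangle_sub[of y "z (k + 1)"] unfolding r_def by linarith
    have nz: "norm (z j) \<le> r" for j using zr[of j] r00 unfolding r_def by linarith
    define S where "S = norm (z (k + 2) - z (k + 1)) + norm (z (k + 2) - y)"
    have "norm (z (k + 2) - y) \<le> D1 + norm (y - z (k + 1))"
      using norm_triangle_ineq4[of "z (k + 2) - z (k + 1)" "y - z (k + 1)"] by (simp add: D1_def)
    moreover have "D0 \<ge> 0" by (simp add: D0_def)
    moreover have "S = D1 + norm (z (k + 2) - y)" by (simp add: S_def D1_def)
    ultimately have "S \<le> 2 * (D1 + D0)" using y by simp
    then have "B * S * norm (x - z (k + 2)) \<le> B * (2 * (D1 + D0)) * norm (x - z (k + 2))"
      using B(1) by (intro mult_right_mono mult_left_mono) simp_all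
    then have "v (k + 2) - (2 * B) * (D1 + D0) * norm (x - z (k + 2)) - A * (norm (x - z (k + 2)))\<^sup>2
        \<le> v (k + 2) - B * S * norm (x - z (k + 2)) - A * (norm (x - z (k + 2)))\<^sup>2"
      unfolding mult.assoc mult.left_commute[of 2 B] by linarith
    moreover have "ereal (v (k + 2) - B * S * norm (x - z (k + 2)) - A * (norm (x - z (k + 2)))\<^sup>2) \<le> ?J x"
      unfolding A_def B_def S_def
      by (rule block_pass_objective_lower[OF b Hd A2 adm p vk nz ny nz lip M0 M[OF k1] \<sigma>00 \<sigma>[OF k1] x])
    ultimately show ?thesis unfolding D0_def[symmetric] D1_def[symmetric]
      using order_trans ereal_less_eq(3) by blast
  qed
  have "bounded (range z)" using zr by (auto intro: boundedI)
  moreover have "lsc_on UNIV ?J" by (rule lsc_on_objective[OF A1 A2])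
  moreover have "m \<le> v k" for k using m[of "z k"] vk[of k] by simp
  moreover have "2 * B \<ge> 0" using B(1) by simp
  ultimately have conv: "convergent z"
    by (intro KL_descent_convergent[OF J(1) _ _ vk _ \<alpha> _ B(2) vdesc low])
  show ?thesis
    using conv SUP_norm_on_tail_tendsto_zero[OF pn conv] pn mcomplete_norm_on[OF pn] by simp
qed

end
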